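(* Let $p\ge 1$ be an integer, let $a_1,\dots,a_p\ge 0$ and $b_1,\dots,b_p\ge 0$, and suppose $\sum_{i=1}^{p}(b_i-a_i)>0$. Then for $0<x<1$ Meijer's $G$-function satisfies the integral equation $$\log(1/x)\,G^{p,0}_{p,p}\left(x\left|\begin{array}{c}\mathbf b\\ \mathbf a\end{array}\right.\right)=\int_x^{1}G^{p,0}_{p,p}\left(t\left|\begin{array}{c}\mathbf b\\ \mathbf a\end{array}\right.\right)\sum_{k=1}^{p}\left(\frac{x^{a_k}}{t^{a_k}}-\frac{x^{b_k}}{t^{b_k}}\right)\frac{dt}{t-x}.$$
   Context: Meijer's $G$-function: for $0<z<1$ and any $c>-\min_{1\le k\le p}a_k$, $$G^{p,0}_{p,p}\left(z\left|\begin{array}{c}\mathbf b\\ \mathbf a\end{array}\right.\right)=\lim_{R\to\infty}\frac{1}{2\pi i}\int_{c-iR}^{c+iR}\frac{\Gamma(a_1+s)\cdots\Gamma(a_p+s)}{\Gamma(b_1+s)\cdots\Gamma(b_p+s)}z^{-s}\,ds,$$ where $\mathbf a=(a_1,\dots,a_p)$, $\mathbf b=(b_1,\dots,b_p)$; the limit exists when $\sum_{i=1}^{p}(b_i-a_i)>0$. *)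

theory Defs
  imports "HOL-Complex_Analysis.Complex_Analysis"
begin

text \<open>Parameters are indexed by \<^term>\<open>{1..p}\<close>.  Since \<^const>\<open>Gamma\<close> is 0 at its poles and division
  by 0 gives 0, the quotient below vanishes where some \<open>b k + s\<close> is a pole, in agreement with the
  entire function \<open>1 / Gamma\<close>.  No \<open>a k + s\<close> is a pole on the lines of integration.\<close>

definition meijer_kernel ::
    "nat \<Rightarrow> (nat \<Rightarrow> real) \<Rightarrow> (nat \<Rightarrow> real) \<Rightarrow> real \<Rightarrow> complex \<Rightarrow> complex" where
  "meijer_kernel p b a z s =
     (\<Prod>k=1..p. Gamma (of_real (a k) + s)) / (\<Prod>k=1..p. Gamma (of_real (b k) + s)) *
     of_real z powr (- s)"

text \<open>\<open>meijer_G p b a z\<close> stands for $G^{p,0}_{p,p}(z \mid \mathbf b; \mathbf a)$ with \<open>0 < z < 1\<close>, in this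
  order of the parameters: the common value, for all admissible abscissae \<open>c\<close>, of the principal
  value integral along the vertical line through \<open>c\<close>.\<close>

definition meijer_G :: "nat \<Rightarrow> (nat \<Rightarrow> real) \<Rightarrow> (nat \<Rightarrow> real) \<Rightarrow> real \<Rightarrow> complex" where
  "meijer_G p b a z =
     (THE L. \<forall>c::real. c > - Min (a ` {1..p}) \<longrightarrow>
        ((\<lambda>R::real. 1 / (2 * of_real pi * \<i>) *
            contour_integral (linepath (Complex c (- R)) (Complex c R)) (meijer_kernel p b a z))
         \<longlongrightarrow> L) at_top)"

end

theory Submission
  imports Defs "HOL-Real_Asymp.Real_Asymp"
begin

text \<open>
  Let \<open>\<phi>(s)\<close> be the quotient of Gamma functions in the integrand and \<open>\<mu> = \<Sum>(b\<^sub>k - a\<^sub>k)\<close>.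
  The inversion integral says that \<open>\<phi>\<close> is the Mellin transform of \<open>G\<close> on \<open>(0, 1)\<close>.
  Logarithmic differentiation gives \<open>- \<phi>' = \<phi> \<cdot> Q\<close> with
  \<open>Q(s) = \<Sum>(\<psi>(b\<^sub>k + s) - \<psi>(a\<^sub>k + s))\<close>, \<open>\<psi>\<close> the digamma function. On the side of functions,
  \<open>- d/ds\<close> is multiplication by \<open>ln (1/x)\<close>, and the product \<open>\<phi> \<cdot> Q\<close> is a multiplicative
  convolution. The partial fraction series of \<open>\<psi>\<close> turns, by the geometric series, into
  \<open>x\<^sup>-\<^sup>s Q(s) = \<integral>\<^sub>x\<^sup>\<infinity> K(x,t) t\<^sup>-\<^sup>s dt\<close>, where \<open>K(x,t)\<close> is the kernel of the theorem
  (\<open>mellin_transform_volterra_kernel\<close>). Since \<open>G\<close> continues by \<open>0\<close> to \<open>t > 1\<close>, the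
  convolution integral ends at \<open>1\<close>.

  For \<open>\<mu> \<le> 1\<close> the inversion integral converges only conditionally, so that the two integrations
  cannot be exchanged directly. The argument is therefore carried out for the truncated integral
  \<open>G\<^sub>R(t)\<close> over \<open>[1 - iR, 1 + iR]\<close>, for which the exchange is harmless: Fubini's theorem gives
  \<open>\<integral>\<^sub>x\<^sup>\<infinity> K(x,t) G\<^sub>R(t) dt = (1/2\<pi>) \<integral> \<phi> Q x\<^sup>-\<^sup>s\<close> (\<open>fubini_volterra_bromwich\<close>), and integration by
  parts identifies the right-hand side with \<open>ln (1/x) G\<^sub>R(x)\<close> up to a boundary term that vanishes
  as \<open>R\<close> grows (\<open>bromwich_by_parts\<close>). It remains to pass to the limit under the integral sign.

  A majorant comes from the decay of \<open>\<phi>\<close>. With \<open>m = min \<mu> (1/2)\<close>, one has \<open>\<phi>(s) = O(\<bar>s\<bar>\<^sup>-\<^sup>m)\<close> and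
  \<open>\<phi>'(s) = O(\<bar>s\<bar>\<^sup>-\<^sup>m\<^sup>-\<^sup>1)\<close> for \<open>Re s \<ge> 1\<close>: indeed \<open>Q(s) = \<mu>/s + O(\<bar>s\<bar>\<^sup>-\<^sup>3\<^sup>/\<^sup>2)\<close>, and the error is
  integrable along rays, so that \<open>\<phi>(s) s\<^sup>\<mu>\<close> is bounded (\<open>gamma_quotient_bound_excess\<close>).
  Consequently the integral over \<open>\<bar>Im s\<bar> \<le> 1 / \<bar>ln t\<bar>\<close> may be estimated absolutely and the rest by
  parts, which yields \<open>\<bar>G\<^sub>R(t)\<bar> \<le> (D / t) \<bar>ln t\<bar>\<^sup>m\<^sup>-\<^sup>1\<close> uniformly in \<open>R\<close>
  (\<open>bromwich_bound\<close>). The singularity at \<open>t = 1\<close> is integrable, and dominated convergence applies.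

  The pointwise limits come from Cauchy's theorem. The functional equation of \<open>\<Gamma>\<close> carries the decay
  of \<open>\<phi>\<close> on horizontal lines to every vertical strip, so all admissible abscissae give the same
  limit as \<open>c = 1\<close>, which is therefore the value of \<open>G\<close> (\<open>bromwich_tendsto_meijer_G\<close>); for \<open>t > 1\<close>
  the line can be moved far to the right, and the limit is \<open>0\<close> (\<open>bromwich_tendsto_0\<close>).
\<close>

section \<open>First-order asymptotics of the digamma function\<close>

lemma Digamma_diff_sums:
  fixes z w :: "'a :: {real_normed_field, banach}"
  assumes "z \<noteq> 0" "w \<noteq> 0"
  shows "(\<lambda>n. 1 / (w + of_nat n) - 1 / (z + of_nat n)) sums (Digamma z - Digamma w)"
proof -
  have S: "(\<lambda>n. inverse (of_nat (Suc n)) - inverse (u + of_nat n)) sums (Digamma u + euler_mascheroni)"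
    if "u \<noteq> 0" for u :: 'a
    using summable_sums[OF summable_Digamma[OF that]] by (simp add: Digamma_def)
  from sums_diff[OF S[OF assms(1)] S[OF assms(2)]] show ?thesis
    by (simp add: inverse_eq_divide)
qed

text \<open>Subtracting \<open>a\<close> times the telescoping series for \<open>1 / s\<close> from the partial fraction series of
  \<open>\<psi>(a + s) - \<psi>(s)\<close> leaves terms of cubic decay in \<open>s + n\<close>. As both \<open>\<bar>s\<bar>\<close> and \<open>n + 1\<close> are at most
  \<open>\<bar>s + n\<bar>\<close>, the cube can be shared evenly between a power of \<open>\<bar>s\<bar>\<close> and a convergent series. The
  resulting exponent \<open>- 3/2\<close> is not sharp, but an exponent below \<open>- 1\<close> suffices for integrating
  the error out to infinity.\<close>

lemma Digamma_shift_approx: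
  fixes a :: real
  assumes "a \<ge> 0"
  obtains K where "K \<ge> 0"
    and "\<And>s. Re s \<ge> 1 \<Longrightarrow>
      norm (Digamma (of_real a + s) - Digamma s - of_real a / s) \<le> K * norm s powr (-3/2)"
proof -
  define Z where "Z = (\<Sum>n. real (Suc n) powr (-3/2))"
  have summ: "summable (\<lambda>n. real (Suc n) powr (-3/2))"
    using summable_real_powr_iff[of "-3/2"] by (subst summable_Suc_iff) simp
  define K where "K = a * \<bar>1 - a\<bar> * Z"
  have "Z \<ge> 0" unfolding Z_def by (intro suminf_nonneg summ) auto
  then have "K \<ge> 0" using assms by (simp add: K_def)
  moreover have "norm (Digamma (of_real a + s) - Digamma s - of_real a / s) \<le> K * norm s powr (-3/2)"
    if s: "Re s \<ge> 1" for s
  proof -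
    have nz: "s + of_nat n \<noteq> 0" "of_real a + s + of_nat n \<noteq> 0" "s + of_nat n + 1 \<noteq> 0" for n
    proof -
      have "Re (s + of_nat n) > 0" "Re (of_real a + s + of_nat n) > 0" "Re (s + of_nat n + 1) > 0"
        using s assms by auto
      then show "s + of_nat n \<noteq> 0" "of_real a + s + of_nat n \<noteq> 0" "s + of_nat n + 1 \<noteq> 0"
        by (metis zero_complex.sel(1) less_irrefl)+
    qed
    have S1: "(\<lambda>n. 1 / (s + of_nat n) - 1 / (of_real a + s + of_nat n)) sums
        (Digamma (of_real a + s) - Digamma s)"
      using nz[of 0] by (intro Digamma_diff_sums) auto
    have "(\<lambda>n. 1 / (s + of_nat n) - 1 / (s + of_nat (Suc n))) sums (1 / (s + of_nat 0) - 0)"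
      by (intro telescope_sums'  tendsto_divide_0[OF tendsto_const] 
            tendsto_add_filterlim_at_infinity[OF tendsto_const] tendsto_of_nat)
    then have S2: "(\<lambda>n. of_real a * (1 / (s + of_nat n) - 1 / (s + of_nat (Suc n)))) sums (of_real a * (1 / s))"
      by (intro sums_mult) simp
    define T where "T n = of_real (a * (1 - a)) /
      ((s + of_nat n) * (s + of_nat n + 1) * (of_real a + s + of_nat n))" for n
    have T_eq: "1 / (s + of_nat n) - 1 / (of_real a + s + of_nat n) -
        of_real a * (1 / (s + of_nat n) - 1 / (s + of_nat (Suc n))) = T n" for n
    proof -
      have "1 / w - 1 / (c + w) - c * (1 / w - 1 / (w + 1)) = c * (1 - c) / (w * (w + 1) * (c + w))"
        if "w \<noteq> 0" "w + 1 \<noteq> 0" "c + w \<noteq> 0" for w c :: complex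
        using that by (simp add: divide_simps) (simp add: algebra_simps)
      from this[of "s + of_nat n" "of_real a"] show ?thesis
        using nz[of n] by (simp add: T_def add_ac)
    qed
    have ST: "T sums (Digamma (of_real a + s) - Digamma s - of_real a / s)"
      using sums_diff[OF S1 S2] by (simp only: T_eq) simp
    have T_le: "norm (T n) \<le> a * \<bar>1 - a\<bar> * norm s powr (-3/2) * real (Suc n) powr (-3/2)" for n
    proof -
      define r where "r = norm (s + of_nat n)"
      have cm: "norm z \<le> norm (z + of_real d)" if "Re z \<ge> 0" "d \<ge> 0" for z d
        using that by (auto simp: norm_complex_def intro!: power_mono)
      have r1: "norm s \<le> r" unfolding r_def using cm[of s "real n"] s by simp
      have r2: "real (Suc n) \<le> r"
        unfolding r_def using complex_Re_le_cmod[of "s + of_nat n"] s by simp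
      have r3: "r \<le> norm (s + of_nat n + 1)" unfolding r_def using cm[of "s + of_nat n" 1] s by simp
      have r4: "r \<le> norm (of_real a + s + of_nat n)"
        unfolding r_def using cm[of "s + of_nat n" a] s assms by (simp add: add_ac)
      have sp: "norm s > 0" using nz[of 0] by auto
      have rp: "r > 0" using r2 by linarith
      have "norm (T n) = a * \<bar>1 - a\<bar> / (r * norm (s + of_nat n + 1) * norm (of_real a + s + of_nat n))"
        unfolding T_def norm_divide norm_mult r_def norm_of_real using assms by (simp add: abs_mult)
      also have "\<dots> \<le> a * \<bar>1 - a\<bar> / (r * r * r)"
        using rp r3 r4 assms by (intro divide_left_mono mult_mono mult_pos_pos) auto
      also have "r * r * r = r powr (3/2) * r powr (3/2)"
        using rp by (simp flip: powr_add) (simp add: eval_nat_numeral)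
      also have "a * \<bar>1 - a\<bar> / (r powr (3/2) * r powr (3/2)) \<le>
          a * \<bar>1 - a\<bar> / (norm s powr (3/2) * real (Suc n) powr (3/2))"
        using rp sp r1 r2 assms
        by (intro divide_left_mono mult_mono mult_pos_pos powr_mono2) auto
      also have "\<dots> = a * \<bar>1 - a\<bar> * norm s powr (-3/2) * real (Suc n) powr (-3/2)"
        by (simp add: powr_minus field_simps)
      finally show ?thesis .
    qed
    have "norm (suminf T) \<le> (\<Sum>n. a * \<bar>1 - a\<bar> * norm s powr (-3/2) * real (Suc n) powr (-3/2))"
      by (intro norm_suminf_le T_le summable_mult summ)
    also have "\<dots> = a * \<bar>1 - a\<bar> * norm s powr (-3/2) * Z"
      unfolding Z_def by (intro suminf_mult summ)
    finally show ?thesis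
      using ST by (simp add: sums_iff K_def mult_ac)
  qed
  ultimately show ?thesis using that by blast
qed

section \<open>The quotient of Gamma functions in a right half-plane\<close>

text \<open>Along such a ray an error of order \<open>- 3/2\<close> is therefore integrable with a bound that does not
  depend on the direction.\<close>

lemma ray_from_one_norm_ge:
  assumes "norm e = 1" "Re e \<ge> 0" "l \<ge> 0"
  shows "(1 + l) / 2 \<le> norm (1 + of_real l * e)"
proof -
  have "1 \<le> Re (1 + of_real l * e)" using assms by simp
  also have "\<dots> \<le> norm (1 + of_real l * e)" by (rule complex_Re_le_cmod)
  finally have 1: "1 \<le> norm (1 + of_real l * e)" .
  have "l = norm (of_real l * e)" using assms by (simp add: norm_mult)
  also have "\<dots> \<le> norm (1 + of_real l * e)"
    using assms by (auto simp: norm_complex_def intro!: power_mono)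
  finally have 2: "l \<le> norm (1 + of_real l * e)" .
  have "(1 + l) / 2 \<le> r" if "1 \<le> r" "l \<le> r" for r :: real using that by simp
  from this[OF 1 2] show ?thesis .
qed

locale meijer_parameters =
  fixes p :: nat and a b :: "nat \<Rightarrow> real"
  assumes p_pos: "p \<ge> 1"
    and a_nonneg: "\<And>k. k \<in> {1..p} \<Longrightarrow> a k \<ge> 0"
    and b_nonneg: "\<And>k. k \<in> {1..p} \<Longrightarrow> b k \<ge> 0"
    and excess_pos: "(\<Sum>k=1..p. b k - a k) > 0"
begin

definition gamma_quotient :: "complex \<Rightarrow> complex" where
  "gamma_quotient s =
     (\<Prod>k=1..p. Gamma (of_real (a k) + s)) / (\<Prod>k=1..p. Gamma (of_real (b k) + s))"

definition digamma_excess :: "complex \<Rightarrow> complex" where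
  "digamma_excess s = (\<Sum>k=1..p. Digamma (of_real (b k) + s) - Digamma (of_real (a k) + s))"

text \<open>A logarithm of the quotient that is holomorphic in the right half-plane; its derivative is
  additive in the parameters.\<close>

definition log_quotient :: "complex \<Rightarrow> complex" where
  "log_quotient s = (\<Sum>k=1..p. ln_Gamma (of_real (a k) + s) - ln_Gamma (of_real (b k) + s))"

definition excess :: real where
  "excess = (\<Sum>k=1..p. b k - a k)"

text \<open>An exponent that is at most the excess and lies in \<open>(0, 1)\<close>: below \<open>1\<close> the
  bound \<open>\<bar>\<tau>\<bar> powr (- decay)\<close> is integrable at \<open>0\<close>, and one argument covers every positive excess.\<close>

definition decay :: real where
  "decay = min excess (1/2)"

lemma excess_gt_0: "excess > 0"
  using excess_pos by (simp add: excess_def)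

lemma decay: "0 < decay" "decay < 1" "decay \<le> excess"
  using excess_gt_0 by (auto simp: decay_def)

lemma right_half_plane_Reals:
  assumes "Re s > 0" "k \<in> {1..p}"
  shows "of_real (a k) + s \<notin> \<real>\<^sub>\<le>\<^sub>0" "of_real (b k) + s \<notin> \<real>\<^sub>\<le>\<^sub>0"
  using assms a_nonneg[OF assms(2)] b_nonneg[OF assms(2)] by (auto simp: complex_nonpos_Reals_iff)

lemma right_half_plane_Ints:
  assumes "Re s > 0" "k \<in> {1..p}"
  shows "of_real (a k) + s \<notin> \<int>\<^sub>\<le>\<^sub>0" "of_real (b k) + s \<notin> \<int>\<^sub>\<le>\<^sub>0"
  using right_half_plane_Reals[OF assms] nonpos_Ints_subset_nonpos_Reals by auto

lemma gamma_quotient_eq_exp: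
  assumes "Re s > 0"
  shows "gamma_quotient s = exp (log_quotient s)"
  using right_half_plane_Ints[OF assms]
  by (simp add: gamma_quotient_def log_quotient_def exp_sum exp_diff prod_dividef Gamma_complex_altdef)

lemma has_field_derivative_log_quotient:
  assumes "Re s > 0"
  shows "(log_quotient has_field_derivative - digamma_excess s) (at s)"
proof -
  have "((\<lambda>s. \<Sum>k=1..p. ln_Gamma (of_real (a k) + s) - ln_Gamma (of_real (b k) + s))
     has_field_derivative (\<Sum>k=1..p. Digamma (of_real (a k) + s) - Digamma (of_real (b k) + s))) (at s)"
    using right_half_plane_Reals[OF assms]
    by (intro DERIV_sum) (auto intro!: derivative_eq_intros)
  then show ?thesis
    unfolding digamma_excess_def sum_negf[symmetric] minus_diff_eq
    by (simp add: log_quotient_def[abs_def])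
qed

lemma has_field_derivative_gamma_quotient:
  assumes "Re s > 0"
  shows "(gamma_quotient has_field_derivative - gamma_quotient s * digamma_excess s) (at s)"
proof (rule has_field_derivative_transform_within_open)
  show "((\<lambda>s. exp (log_quotient s)) has_field_derivative - gamma_quotient s * digamma_excess s) (at s)"
    using has_field_derivative_log_quotient[OF assms]
    by (auto intro!: derivative_eq_intros simp: gamma_quotient_eq_exp assms)
  show "open {s. Re s > 0}" by (rule open_halfspace_Re_gt)
qed (use assms in \<open>auto simp: gamma_quotient_eq_exp\<close>)

lemma digamma_excess_approx:
  obtains K where "K \<ge> 0"
    and "\<And>s. Re s \<ge> 1 \<Longrightarrow> norm (digamma_excess s - of_real excess / s) \<le> K * norm s powr (-3/2)"
proof -
  let ?err = "\<lambda>c s. Digamma (of_real c + s) - Digamma s - of_real c / s"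
  have "\<exists>K. K \<ge> 0 \<and> (\<forall>s. Re s \<ge> 1 \<longrightarrow> norm (?err c s) \<le> K * norm s powr (-3/2))"
    if "c \<ge> 0" for c
    using Digamma_shift_approx[OF that] by metis
  then obtain K where K: "\<And>c. c \<ge> 0 \<Longrightarrow> K c \<ge> 0"
      "\<And>c s. c \<ge> 0 \<Longrightarrow> Re s \<ge> 1 \<Longrightarrow> norm (?err c s) \<le> K c * norm s powr (-3/2)"
    by metis
  define K' where "K' = (\<Sum>k=1..p. K (a k) + K (b k))"
  show ?thesis
  proof (rule that[of K'])
    show "K' \<ge> 0" unfolding K'_def using K(1) a_nonneg b_nonneg by (intro sum_nonneg add_nonneg_nonneg) auto
    fix s :: complex assume s: "Re s \<ge> 1"
    have "digamma_excess s - of_real excess / s = (\<Sum>k=1..p. ?err (b k) s - ?err (a k) s)"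
      unfolding digamma_excess_def excess_def of_real_sum sum_divide_distrib sum_subtractf[symmetric]
      by (intro sum.cong) (auto simp: diff_divide_distrib)
    also have "norm \<dots> \<le> (\<Sum>k=1..p. (K (a k) + K (b k)) * norm s powr (-3/2))"
    proof (intro sum_norm_le)
      fix k assume k: "k \<in> {1..p}"
      have "norm (?err (b k) s - ?err (a k) s) \<le> norm (?err (b k) s) + norm (?err (a k) s)"
        by (rule norm_triangle_ineq4)
      also have "\<dots> \<le> K (b k) * norm s powr (-3/2) + K (a k) * norm s powr (-3/2)"
        using k s a_nonneg b_nonneg by (intro add_mono K(2)) auto
      finally show "norm (?err (b k) s - ?err (a k) s) \<le> (K (a k) + K (b k)) * norm s powr (-3/2)"
        by (simp add: algebra_simps)
    qed
    also have "\<dots> = K' * norm s powr (-3/2)" by (simp add: K'_def sum_distrib_right)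
    finally show "norm (digamma_excess s - of_real excess / s) \<le> K' * norm s powr (-3/2)" .
  qed
qed

lemma digamma_excess_bound:
  obtains C where "C \<ge> 0" and "\<And>s. Re s \<ge> 1 \<Longrightarrow> norm (digamma_excess s) \<le> C / norm s"
proof -
  obtain K where K: "K \<ge> 0"
    "\<And>s. Re s \<ge> 1 \<Longrightarrow> norm (digamma_excess s - of_real excess / s) \<le> K * norm s powr (-3/2)"
    using digamma_excess_approx by blast
  show ?thesis
  proof (rule that[of "K + excess"])
    show "K + excess \<ge> 0" using K excess_gt_0 by simp
    fix s :: complex assume s: "Re s \<ge> 1"
    have s1: "norm s \<ge> 1" using s complex_Re_le_cmod[of s] by linarith
    have "norm (digamma_excess s) \<le> norm (digamma_excess s - of_real excess / s) + norm (of_real excess / s)"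
      using norm_triangle_sub by (simp add: add.commute)
    also have "\<dots> \<le> K * norm s powr (-3/2) + excess / norm s"
      using K(2)[OF s] excess_gt_0 by (simp add: norm_divide)
    also have "norm s powr (-3/2) \<le> norm s powr (-1)" using s1 by (intro powr_mono) auto
    also have "norm s powr (-1) = 1 / norm s" using s1 by (simp add: powr_minus field_simps)
    finally show "norm (digamma_excess s) \<le> (K + excess) / norm s"
      using K(1) by (simp add: add_divide_distrib mult_left_mono)
  qed
qed

text \<open>The function \<open>H(s) = log \<phi>(s) + \<mu> Ln s\<close> has derivative \<open>\<mu> / s - Q(s)\<close>, whose norm is
  integrable along the ray from \<open>1\<close> to any \<open>s\<close> with \<open>Re s \<ge> 1\<close>. Hence \<open>H\<close> is bounded there, and so is
  \<open>\<phi>(s) s\<^sup>\<mu> = exp (H(s))\<close>.\<close>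

lemma gamma_quotient_bound_excess:
  obtains C where "C \<ge> 0" and "\<And>s. Re s \<ge> 1 \<Longrightarrow> norm (gamma_quotient s) \<le> C * norm s powr (- excess)"
proof -
  obtain K where K: "K \<ge> 0"
    "\<And>s. Re s \<ge> 1 \<Longrightarrow> norm (digamma_excess s - of_real excess / s) \<le> K * norm s powr (-3/2)"
    using digamma_excess_approx by blast
  define H where "H s = log_quotient s + of_real excess * Ln s" for s
  define B where "B = 2 * K * 2 powr (3/2)"
  have H_deriv: "(H has_field_derivative of_real excess / s - digamma_excess s) (at s)" if "Re s > 0" for s
    unfolding H_def[abs_def] using has_field_derivative_log_quotient[OF that] that
    by (auto intro!: derivative_eq_intros simp: complex_nonpos_Reals_iff field_simps)
  have H_le: "norm (H s - H 1) \<le> B" if s: "Re s \<ge> 1" for s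
  proof (cases "s = 1")
    case True
    then show ?thesis using K by (simp add: B_def)
  next
    case False
    \<comment> \<open>The segment from \<open>1\<close> to \<open>s\<close>, parametrised by arc length.\<close>
    define L where "L = norm (s - 1)"
    define e where "e = (s - 1) / of_real L"
    have L: "L > 0" using False by (simp add: L_def)
    have e: "norm e = 1" "Re e \<ge> 0" using L s by (auto simp: e_def norm_divide L_def)
    have sL: "s = 1 + of_real L * e" using L by (simp add: e_def)
    define w where "w l = 1 + of_real l * e" for l
    have Re_w: "Re (w l) \<ge> 1" if "l \<ge> 0" for l using that e by (simp add: w_def)
    have f_deriv: "((\<lambda>l. H (w l)) has_vector_derivative e * (of_real excess / w l - digamma_excess (w l))) (at l)"
      if "l \<ge> 0" for l
    proof -
      have "(w has_vector_derivative e) (at l)"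
        unfolding w_def[abs_def] by (auto intro!: derivative_eq_intros)
      from field_vector_diff_chain_at[OF this H_deriv] show ?thesis
        using Re_w[OF that] by (simp add: o_def)
    qed
    \<comment> \<open>An antiderivative of the bound for the derivative; its total increase is at most \<open>B\<close>.\<close>
    define \<phi> where "\<phi> l = - B * (1 + l) powr (-1/2)" for l
    have "norm (H (w L) - H (w 0)) \<le> \<phi> L - \<phi> 0"
    proof (rule differentiable_bound_general[OF L])
      show "continuous_on {0..L} (\<lambda>l. H (w l))"
        using f_deriv by (intro continuous_at_imp_continuous_on ballI has_vector_derivative_continuous) auto
      show "continuous_on {0..L} \<phi>"
        unfolding \<phi>_def[abs_def] by (intro continuous_intros) auto
      fix l assume l: "0 < l" "l < L"
      show "((\<lambda>l. H (w l)) has_vector_derivative e * (of_real excess / w l - digamma_excess (w l))) (at l)"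
        using f_deriv l by simp
      have "(1 + l) powr (3/2) = (1 + l) powr (1/2) * ((1 + l) powr (1/2) * (1 + l) powr (1/2))"
        by (simp only: powr_add[symmetric]) simp
      then show "(\<phi> has_vector_derivative K * ((1 + l) / 2) powr (-3/2)) (at l)"
        unfolding \<phi>_def[abs_def] has_real_derivative_iff_has_vector_derivative[symmetric] using l
        by (auto intro!: derivative_eq_intros simp: B_def powr_divide powr_minus_divide)
      have "norm (e * (of_real excess / w l - digamma_excess (w l))) \<le> K * norm (w l) powr (-3/2)"
        using K(2)[OF Re_w[of l]] l e by (simp add: norm_mult norm_minus_commute)
      also have "\<dots> \<le> K * ((1 + l) / 2) powr (-3/2)"
        using K(1) l ray_from_one_norm_ge[OF e, of l] unfolding w_def
        by (intro mult_left_mono powr_mono2') auto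
      finally show "norm (e * (of_real excess / w l - digamma_excess (w l))) \<le> K * ((1 + l) / 2) powr (-3/2)" .
    qed
    also have "\<dots> \<le> B" using K(1) by (simp add: \<phi>_def B_def)
    finally show ?thesis by (simp add: w_def sL[symmetric])
  qed
  show ?thesis
  proof (rule that[of "exp (norm (H 1) + B)"])
    fix s :: complex assume s: "Re s \<ge> 1"
    then have nz: "s \<noteq> 0" by auto
    have "Re (H s) \<le> norm (H 1) + B"
      using H_le[OF s] complex_Re_le_cmod[of "H s"] norm_triangle_sub[of "H s" "H 1"] by linarith
    moreover have "norm (gamma_quotient s) = exp (Re (H s)) * norm s powr (- excess)"
      using s nz by (simp add: gamma_quotient_eq_exp H_def powr_def flip: exp_add)
    ultimately show "norm (gamma_quotient s) \<le> exp (norm (H 1) + B) * norm s powr (- excess)"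
      by (simp add: mult_right_mono)
  qed simp
qed

lemma gamma_quotient_bound:
  obtains C where "C \<ge> 0" and "\<And>s. Re s \<ge> 1 \<Longrightarrow> norm (gamma_quotient s) \<le> C * norm s powr (- decay)"
proof -
  obtain C where C: "C \<ge> 0" "\<And>s. Re s \<ge> 1 \<Longrightarrow> norm (gamma_quotient s) \<le> C * norm s powr (- excess)"
    using gamma_quotient_bound_excess by blast
  have "C * norm s powr (- excess) \<le> C * norm s powr (- decay)" if "Re s \<ge> 1" for s
    using that C(1) decay complex_Re_le_cmod[of s] by (intro mult_left_mono powr_mono) auto
  with C that[of C] show ?thesis by (meson order_trans)
qed

lemma gamma_quotient_rec:
  assumes "Im s \<noteq> 0"
  shows "gamma_quotient s = gamma_quotient (s + 1) *
           (\<Prod>k=1..p. (of_real (b k) + s) / (of_real (a k) + s))"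
proof -
  have G: "Gamma (of_real c + (s + 1)) = (of_real c + s) * Gamma (of_real c + s)" and nz: "of_real c + s \<noteq> 0" for c
  proof -
    have "of_real c + s \<notin> \<int>\<^sub>\<le>\<^sub>0" using assms by (auto elim!: nonpos_Ints_cases simp: complex_eq_iff)
    from Gamma_plus1[OF this] show "Gamma (of_real c + (s + 1)) = (of_real c + s) * Gamma (of_real c + s)"
      by (simp add: add_ac)
    show "of_real c + s \<noteq> 0" using assms by (auto simp: complex_eq_iff)
  qed
  show ?thesis
    by (simp add: gamma_quotient_def G prod.distrib prod_dividef nz)
qed

text \<open>Each use of the functional equation gains one unit of width to the left, at the cost of a
  factor that is bounded away from the real axis. This makes abscissae \<open>c < 1\<close> accessible, where
  the estimate along rays from \<open>1\<close> says nothing.\<close>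

lemma gamma_quotient_bound_strip:
  "\<exists>D\<ge>0. \<forall>s. Re s \<ge> 1 - real N \<longrightarrow> \<bar>Im s\<bar> \<ge> 1 \<longrightarrow> norm (gamma_quotient s) \<le> D * \<bar>Im s\<bar> powr (- decay)"
proof (induction N)
  case 0
  obtain C where C: "C \<ge> 0" "\<And>s. Re s \<ge> 1 \<Longrightarrow> norm (gamma_quotient s) \<le> C * norm s powr (- decay)"
    using gamma_quotient_bound by blast
  have "norm (gamma_quotient s) \<le> C * \<bar>Im s\<bar> powr (- decay)" if "Re s \<ge> 1" "\<bar>Im s\<bar> \<ge> 1" for s
  proof -
    have "C * norm s powr (- decay) \<le> C * \<bar>Im s\<bar> powr (- decay)"
      using that C(1) decay abs_Im_le_cmod[of s] by (intro mult_left_mono powr_mono2') auto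
    then show ?thesis using C(2)[OF that(1)] by linarith
  qed
  then show ?case using C(1) by (intro exI[of _ C]) auto
next
  case (Suc N)
  then obtain D where D: "D \<ge> 0"
    "\<And>s. Re s \<ge> 1 - real N \<Longrightarrow> \<bar>Im s\<bar> \<ge> 1 \<Longrightarrow> norm (gamma_quotient s) \<le> D * \<bar>Im s\<bar> powr (- decay)"
    by blast
  define P where "P = (\<Prod>k=1..p. 1 + \<bar>b k - a k\<bar>)"
  have P: "P \<ge> 0" unfolding P_def by (intro prod_nonneg) auto
  have "norm (gamma_quotient s) \<le> D * P * \<bar>Im s\<bar> powr (- decay)"
    if s: "Re s \<ge> 1 - real (Suc N)" "\<bar>Im s\<bar> \<ge> 1" for s
  proof -
    have "norm (\<Prod>k=1..p. (of_real (b k) + s) / (of_real (a k) + s)) \<le> P"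
      unfolding P_def prod_norm[symmetric]
    proof (intro prod_mono conjI norm_ge_zero)
      fix k
      define z where "z = of_real (a k) + s"
      have z: "norm z \<ge> 1" using abs_Im_le_cmod[of z] s(2) by (simp add: z_def)
      then have "z \<noteq> 0" by auto
      have "(of_real (b k) + s) / z = 1 + of_real (b k - a k) / z"
        using \<open>z \<noteq> 0\<close> by (simp add: z_def field_simps)
      also have "norm \<dots> \<le> 1 + norm (of_real (b k - a k) / z)"
        using norm_triangle_ineq[of 1 "of_real (b k - a k) / z"] by simp
      also have "norm (of_real (b k - a k) / z) \<le> \<bar>b k - a k\<bar> / 1"
        unfolding norm_divide norm_of_real using z by (intro divide_left_mono) auto
      finally show "norm ((of_real (b k) + s) / (of_real (a k) + s)) \<le> 1 + \<bar>b k - a k\<bar>"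
        by (simp add: z_def)
    qed
    moreover have "norm (gamma_quotient (s + 1)) \<le> D * \<bar>Im s\<bar> powr (- decay)"
      using D(2)[of "s + 1"] s by simp
    ultimately have "norm (gamma_quotient s) \<le> (D * \<bar>Im s\<bar> powr (- decay)) * P"
      using s(2) D(1) P by (subst gamma_quotient_rec) (auto simp: norm_mult intro!: mult_mono)
    then show ?thesis by (simp add: mult_ac)
  qed
  then show ?case using D(1) P by (intro exI[of _ "D * P"]) auto
qed

end

section \<open>Oscillatory integrals with slowly decaying symbols\<close>

text \<open>Multiplication of the oscillatory integral by the frequency amounts to differentiation of the
  symbol. Read for \<open>l = ln t\<close>, this is the correspondence of \<open>ln (1/t) G(t)\<close> with \<open>- \<phi>'\<close>.\<close>

lemma oscillatory_by_parts:
  fixes f f' :: "real \<Rightarrow> complex"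
  assumes deriv: "\<And>\<tau>. (f has_vector_derivative f' \<tau>) (at \<tau>)"
    and cont: "continuous_on UNIV f'" and "A \<le> B"
  shows "\<i> * of_real l * integral {A..B} (\<lambda>\<tau>. f \<tau> * cis (- l * \<tau>)) =
    integral {A..B} (\<lambda>\<tau>. f' \<tau> * cis (- l * \<tau>)) - (f B * cis (- l * B) - f A * cis (- l * A))"
proof -
  have cf: "continuous_on S f" for S
    using deriv by (meson continuous_at_imp_continuous_on has_vector_derivative_continuous)
  have cf': "continuous_on S f'" for S using cont continuous_on_subset by blast
  have e: "((\<lambda>\<tau>. cis (- l * \<tau>)) has_vector_derivative - \<i> * of_real l * cis (- l * \<tau>)) (at \<tau>)" for \<tau>
    using exp_scaleR_has_vector_derivative_right[of "- \<i> * of_real l" \<tau> UNIV]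
    by (simp add: cis_conv_exp scaleR_conv_of_real mult_ac)
  have "((\<lambda>\<tau>. f' \<tau> * cis (- l * \<tau>) - \<i> * of_real l * (f \<tau> * cis (- l * \<tau>))) has_integral
      (f B * cis (- l * B) - f A * cis (- l * A))) {A..B}"
  proof (rule fundamental_theorem_of_calculus[OF \<open>A \<le> B\<close>])
    fix \<tau> assume "\<tau> \<in> {A..B}"
    from has_vector_derivative_mult[OF deriv[of \<tau>] e[of \<tau>]]
    have "((\<lambda>\<tau>. f \<tau> * cis (- l * \<tau>)) has_vector_derivative
      f' \<tau> * cis (- l * \<tau>) - \<i> * of_real l * (f \<tau> * cis (- l * \<tau>))) (at \<tau>)"
      by (simp add: algebra_simps)
    then show "((\<lambda>\<tau>. f \<tau> * cis (- l * \<tau>)) has_vector_derivative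
      f' \<tau> * cis (- l * \<tau>) - \<i> * of_real l * (f \<tau> * cis (- l * \<tau>))) (at \<tau> within {A..B})"
      by (rule has_vector_derivative_at_within)
  qed
  moreover have "(\<lambda>\<tau>. f \<tau> * cis (- l * \<tau>)) integrable_on {A..B}" "(\<lambda>\<tau>. f' \<tau> * cis (- l * \<tau>)) integrable_on {A..B}"
    by (intro integrable_continuous_real continuous_intros cf cf')+
  ultimately show ?thesis
    by (subst (asm) has_integral_iff) (simp add: integral_diff integrable_on_cmult_left algebra_simps)
qed

text \<open>The symbol itself need not be integrable at infinity, whereas its derivative is; the oscillatory
  integrals below converge for this reason only.\<close>

locale symbol_with_decay =
  fixes f f' :: "real \<Rightarrow> complex" and C m :: real
  assumes deriv: "\<And>\<tau>. (f has_vector_derivative f' \<tau>) (at \<tau>)"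
    and cont': "continuous_on UNIV f'"
    and C: "C \<ge> 0" and m: "0 < m" "m < 1"
    and bound: "\<And>\<tau>. \<tau> \<noteq> 0 \<Longrightarrow> norm (f \<tau>) \<le> C * \<bar>\<tau>\<bar> powr (- m)"
    and bound': "\<And>\<tau>. \<tau> \<noteq> 0 \<Longrightarrow> norm (f' \<tau>) \<le> C * \<bar>\<tau>\<bar> powr (- m - 1)"
begin

lemma cont: "continuous_on S f"
  using deriv by (meson continuous_at_imp_continuous_on has_vector_derivative_continuous)

lemma integrable_osc: "(\<lambda>\<tau>. f \<tau> * cis (- l * \<tau>)) integrable_on {A..B}"
  by (intro integrable_continuous_real continuous_intros cont)

lemma tail_bound:
  assumes "0 < A" "A \<le> B" "l \<noteq> 0"
  shows "norm (integral {A..B} (\<lambda>\<tau>. f \<tau> * cis (- l * \<tau>))) \<le> C * (2 + 1 / m) * A powr (- m) / \<bar>l\<bar>"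
proof -
  have I: "((\<lambda>\<tau>. C * \<tau> powr (- m - 1)) has_integral (- C / m * B powr (- m) - (- C / m * A powr (- m)))) {A..B}"
  proof (rule fundamental_theorem_of_calculus)
    fix \<tau> assume "\<tau> \<in> {A..B}"
    then have "((\<lambda>\<tau>. - C / m * \<tau> powr (- m)) has_real_derivative C * \<tau> powr (- m - 1)) (at \<tau>)"
      using assms m by (auto intro!: derivative_eq_intros)
    then show "((\<lambda>\<tau>. - C / m * \<tau> powr (- m)) has_vector_derivative C * \<tau> powr (- m - 1)) (at \<tau> within {A..B})"
      by (auto simp: has_real_derivative_iff_has_vector_derivative intro: has_vector_derivative_at_within)
  qed (use assms in auto)
  have "norm (integral {A..B} (\<lambda>\<tau>. f' \<tau> * cis (- l * \<tau>))) \<le> integral {A..B} (\<lambda>\<tau>. C * \<tau> powr (- m - 1))"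
  proof (rule integral_norm_bound_integral)
    show "(\<lambda>\<tau>. f' \<tau> * cis (- l * \<tau>)) integrable_on {A..B}"
      by (intro integrable_continuous_real continuous_intros continuous_on_subset[OF cont']) auto
    show "norm (f' \<tau> * cis (- l * \<tau>)) \<le> C * \<tau> powr (- m - 1)" if "\<tau> \<in> {A..B}" for \<tau>
      using bound'[of \<tau>] that assms by (simp add: norm_mult)
  qed (use I in \<open>auto simp: has_integral_iff\<close>)
  also have "\<dots> \<le> C / m * A powr (- m)"
    using I C m by (simp add: has_integral_iff)
  finally have 1: "norm (integral {A..B} (\<lambda>\<tau>. f' \<tau> * cis (- l * \<tau>))) \<le> C / m * A powr (- m)" .
  have 2: "norm (f A * cis (- l * A)) \<le> C * A powr (- m)"
    using bound[of A] assms by (simp add: norm_mult)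
  have "norm (f B * cis (- l * B)) \<le> C * B powr (- m)"
    using bound[of B] assms by (simp add: norm_mult)
  also have "\<dots> \<le> C * A powr (- m)" using assms C m by (intro mult_left_mono powr_mono2') auto
  finally have 3: "norm (f B * cis (- l * B)) \<le> C * A powr (- m)" .
  have "\<bar>l\<bar> * norm (integral {A..B} (\<lambda>\<tau>. f \<tau> * cis (- l * \<tau>))) =
      norm (\<i> * of_real l * integral {A..B} (\<lambda>\<tau>. f \<tau> * cis (- l * \<tau>)))"
    by (simp add: norm_mult)
  also have "\<dots> \<le> C / m * A powr (- m) + (C * A powr (- m) + C * A powr (- m))"
    unfolding oscillatory_by_parts[OF deriv cont' \<open>A \<le> B\<close>]
    by (intro order_trans[OF norm_triangle_ineq4] add_mono order_trans[OF norm_triangle_ineq4[of "f B * _"]] 1 2 3)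
  finally show ?thesis using assms by (simp add: field_simps)
qed

text \<open>The scale is \<open>1 / \<bar>l\<bar>\<close>: up to there the oscillation does not help and the absolute value is
  integrated, beyond it integration by parts gains a factor \<open>1 / \<bar>l\<bar>\<close>. Both contributions have the
  same order, and the bound is uniform in \<open>R\<close>, as dominated convergence requires.\<close>

lemma half_bound:
  assumes "R \<ge> 0" "l \<noteq> 0"
  shows "norm (integral {0..R} (\<lambda>\<tau>. f \<tau> * cis (- l * \<tau>))) \<le> C * (1 / (1 - m) + 2 + 1 / m) * \<bar>l\<bar> powr (m - 1)"
proof -
  have near: "norm (integral {0..r} (\<lambda>\<tau>. f \<tau> * cis (- l * \<tau>))) \<le> C / (1 - m) * \<bar>l\<bar> powr (m - 1)"
    if r: "0 \<le> r" "r \<le> 1 / \<bar>l\<bar>" for r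
  proof -
    \<comment> \<open>At \<open>0\<close> the expression \<open>\<tau> powr (- m)\<close> is \<open>0\<close> by convention and would not dominate.\<close>
    define g where "g \<tau> = (if \<tau> = 0 then norm (f 0) else C * \<tau> powr (- m))" for \<tau>
    have "((\<lambda>\<tau>. C * \<tau> powr (- m)) has_integral C * (r powr (- m + 1) / (- m + 1))) {0..r}"
      using r m by (intro has_integral_mult_right has_integral_powr_from_0) auto
    then have I: "(g has_integral C * (r powr (- m + 1) / (- m + 1))) {0..r}"
      by (rule has_integral_spike_finite[of "{0}", rotated 2]) (auto simp: g_def)
    have "norm (integral {0..r} (\<lambda>\<tau>. f \<tau> * cis (- l * \<tau>))) \<le> integral {0..r} g"
    proof (rule integral_norm_bound_integral)
      show "norm (f \<tau> * cis (- l * \<tau>)) \<le> g \<tau>" if "\<tau> \<in> {0..r}" for \<tau>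
        using bound[of \<tau>] that by (simp add: norm_mult g_def)
    qed (use I integrable_osc in \<open>auto simp: has_integral_iff\<close>)
    also have "\<dots> = C / (1 - m) * r powr (1 - m)" using I by (simp add: has_integral_iff)
    also have "\<dots> \<le> C / (1 - m) * (1 / \<bar>l\<bar>) powr (1 - m)"
      using r C m by (intro mult_left_mono powr_mono2) auto
    also have "(1 / \<bar>l\<bar>) powr (1 - m) = \<bar>l\<bar> powr (m - 1)"
      using \<open>l \<noteq> 0\<close> by (simp add: powr_divide powr_diff)
    finally show ?thesis .
  qed
  show ?thesis
  proof (cases "R \<le> 1 / \<bar>l\<bar>")
    case True
    have "C * (1 / (1 - m)) * \<bar>l\<bar> powr (m - 1) \<le> C * (1 / (1 - m) + 2 + 1 / m) * \<bar>l\<bar> powr (m - 1)"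
      using C m by (intro mult_right_mono mult_left_mono) auto
    then show ?thesis using near[OF _ True] assms by simp
  next
    case False
    define A where "A = 1 / \<bar>l\<bar>"
    have A: "0 < A" "A \<le> R" using False assms by (auto simp: A_def)
    have "integral {0..R} (\<lambda>\<tau>. f \<tau> * cis (- l * \<tau>)) =
        integral {0..A} (\<lambda>\<tau>. f \<tau> * cis (- l * \<tau>)) + integral {A..R} (\<lambda>\<tau>. f \<tau> * cis (- l * \<tau>))"
      using A integrable_osc by (intro Henstock_Kurzweil_Integration.integral_combine[symmetric]) auto
    also have "norm \<dots> \<le> C / (1 - m) * \<bar>l\<bar> powr (m - 1) + C * (2 + 1 / m) * A powr (- m) / \<bar>l\<bar>"
      using A by (intro order_trans[OF norm_triangle_ineq] add_mono near tail_bound assms) (auto simp: A_def)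
    also have "A powr (- m) / \<bar>l\<bar> = \<bar>l\<bar> powr (m - 1)"
      using \<open>l \<noteq> 0\<close> by (simp add: A_def powr_divide powr_diff powr_minus field_simps)
    then have "C * (2 + 1 / m) * A powr (- m) / \<bar>l\<bar> = C * (2 + 1 / m) * \<bar>l\<bar> powr (m - 1)"
      by (metis times_divide_eq_right)
    finally show ?thesis by (simp add: algebra_simps)
  qed
qed

lemma half_convergent:
  assumes "l \<noteq> 0"
  shows "\<exists>L. ((\<lambda>R. integral {0..R} (\<lambda>\<tau>. f \<tau> * cis (- l * \<tau>))) \<longlongrightarrow> L) at_top"
proof -
  define I where "I R = integral {0..R} (\<lambda>\<tau>. f \<tau> * cis (- l * \<tau>))" for R
  define D where "D = C * (2 + 1 / m) / \<bar>l\<bar>"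
  have tail: "norm (I A - I B) \<le> D * A powr (- m)" if "0 < A" "A \<le> B" for A B
  proof -
    have "I B = I A + integral {A..B} (\<lambda>\<tau>. f \<tau> * cis (- l * \<tau>))"
      unfolding I_def using that integrable_osc
      by (intro Henstock_Kurzweil_Integration.integral_combine[symmetric]) auto
    then show ?thesis using tail_bound[OF that \<open>l \<noteq> 0\<close>] by (simp add: D_def)
  qed
  have to0: "((\<lambda>A. D * A powr (- m)) \<longlongrightarrow> 0) at_top"
    using m by (intro tendsto_mult_right_zero tendsto_neg_powr filterlim_ident) auto
  have "Cauchy (\<lambda>n. I (real n))"
  proof (rule CauchyI')
    fix e :: real assume "e > 0"
    have "eventually (\<lambda>n. D * real n powr (- m) < e \<and> n > 0) sequentially"
      using order_tendstoD(2)[OF filterlim_compose[OF to0 filterlim_real_sequentially] \<open>e > 0\<close>]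
      by (intro eventually_conj eventually_gt_at_top) auto
    then obtain N where "\<And>n. n \<ge> N \<Longrightarrow> D * real n powr (- m) < e \<and> n > 0"
      by (auto simp: eventually_at_top_linorder)
    then show "\<exists>M. \<forall>m\<ge>M. \<forall>n>m. dist (I (real m)) (I (real n)) < e"
      unfolding dist_norm
      by (intro exI[of _ N] allI impI) (smt (verit) tail of_nat_0_less_iff of_nat_less_iff)
  qed
  then obtain L where L: "(\<lambda>n. I (real n)) \<longlonglongrightarrow> L"
    using Cauchy_convergent convergent_def by blast
  have "eventually (\<lambda>R. norm (I R - L) \<le> D * R powr (- m)) at_top"
    using eventually_gt_at_top[of 0]
  proof eventually_elim
    case (elim R)
    have lim: "(\<lambda>n. norm (I R - I (real n))) \<longlonglongrightarrow> norm (I R - L)"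
      by (intro tendsto_intros L)
    have "eventually (\<lambda>n. real n \<ge> R) sequentially"
      using filterlim_real_sequentially by (auto simp: filterlim_at_top)
    then have "eventually (\<lambda>n. norm (I R - I (real n)) \<le> D * R powr (- m)) sequentially"
      by eventually_elim (use tail elim in auto)
    with lim show ?case by (rule tendsto_upperbound) simp
  qed
  then have "((\<lambda>R. I R - L) \<longlongrightarrow> 0) at_top"
    using to0 by (rule Lim_null_comparison)
  then show ?thesis by (auto simp: Lim_null[symmetric] I_def)
qed

end

text \<open>The class is closed under reflection, which reduces integrals over the negative half-line to
  those over the positive one with the opposite frequency.\<close>

lemma symbol_with_decay_reflect:
  assumes "symbol_with_decay f f' C m"
  shows "symbol_with_decay (\<lambda>\<tau>. f (- \<tau>)) (\<lambda>\<tau>. - f' (- \<tau>)) C m"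
proof -
  interpret symbol_with_decay f f' C m by fact
  show ?thesis
  proof
    fix \<tau> :: real
    have "(f \<circ> uminus has_vector_derivative (- 1) *\<^sub>R f' (- \<tau>)) (at \<tau>)"
      by (rule vector_diff_chain_at) (auto intro!: derivative_eq_intros deriv)
    then show "((\<lambda>\<tau>. f (- \<tau>)) has_vector_derivative - f' (- \<tau>)) (at \<tau>)"
      by (simp add: o_def)
    show "continuous_on UNIV (\<lambda>\<tau>. - f' (- \<tau>))"
      by (intro continuous_intros continuous_on_compose2[OF cont']) auto
  qed (use C m bound[of "- _"] bound'[of "- _"] in auto)
qed

context symbol_with_decay
begin

lemma symmetric_integral_split:
  assumes "R \<ge> 0"
  shows "integral {-R..R} (\<lambda>\<tau>. f \<tau> * cis (- l * \<tau>)) =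
    integral {0..R} (\<lambda>\<tau>. f (- \<tau>) * cis (- (- l) * \<tau>)) + integral {0..R} (\<lambda>\<tau>. f \<tau> * cis (- l * \<tau>))"
proof -
  have "integral {-R..R} (\<lambda>\<tau>. f \<tau> * cis (- l * \<tau>)) =
      integral {-R..0} (\<lambda>\<tau>. f \<tau> * cis (- l * \<tau>)) + integral {0..R} (\<lambda>\<tau>. f \<tau> * cis (- l * \<tau>))"
    using assms integrable_osc by (intro Henstock_Kurzweil_Integration.integral_combine[symmetric]) auto
  also have "integral {-R..0} (\<lambda>\<tau>. f \<tau> * cis (- l * \<tau>)) = integral {0..R} (\<lambda>\<tau>. f (- \<tau>) * cis (- (- l) * \<tau>))"
    using Henstock_Kurzweil_Integration.integral_reflect_real[of R 0 "\<lambda>\<tau>. f (- \<tau>) * cis (- (- l) * \<tau>)"] by simp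
  finally show ?thesis .
qed

lemma symmetric_bound:
  assumes "R \<ge> 0" "l \<noteq> 0"
  shows "norm (integral {-R..R} (\<lambda>\<tau>. f \<tau> * cis (- l * \<tau>))) \<le>
    2 * (C * (1 / (1 - m) + 2 + 1 / m)) * \<bar>l\<bar> powr (m - 1)"
proof -
  interpret reflected: symbol_with_decay "\<lambda>\<tau>. f (- \<tau>)" "\<lambda>\<tau>. - f' (- \<tau>)" C m
    by (rule symbol_with_decay_reflect) unfold_locales
  define W where "W = C * (1 / (1 - m) + 2 + 1 / m) * \<bar>l\<bar> powr (m - 1)"
  have "norm (integral {-R..R} (\<lambda>\<tau>. f \<tau> * cis (- l * \<tau>))) \<le> W + W"
    unfolding symmetric_integral_split[OF \<open>R \<ge> 0\<close>] W_def
    using reflected.half_bound[of R "- l"] half_bound[of R l] assms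
    by (intro norm_triangle_mono) auto
  then show ?thesis unfolding W_def mult_2[symmetric] by (simp only: mult.assoc)
qed

lemma symmetric_convergent:
  assumes "l \<noteq> 0"
  shows "\<exists>L. ((\<lambda>R. integral {-R..R} (\<lambda>\<tau>. f \<tau> * cis (- l * \<tau>))) \<longlongrightarrow> L) at_top"
proof -
  interpret reflected: symbol_with_decay "\<lambda>\<tau>. f (- \<tau>)" "\<lambda>\<tau>. - f' (- \<tau>)" C m
    by (rule symbol_with_decay_reflect) unfold_locales
  obtain L L' where
    "((\<lambda>R. integral {0..R} (\<lambda>\<tau>. f (- \<tau>) * cis (- (- l) * \<tau>))) \<longlongrightarrow> L') at_top"
    "((\<lambda>R. integral {0..R} (\<lambda>\<tau>. f \<tau> * cis (- l * \<tau>))) \<longlongrightarrow> L) at_top"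
    using reflected.half_convergent[of "- l"] half_convergent[OF assms] assms by auto
  note lim = tendsto_add[OF this]
  have "eventually (\<lambda>R. integral {0..R} (\<lambda>\<tau>. f (- \<tau>) * cis (- (- l) * \<tau>)) +
      integral {0..R} (\<lambda>\<tau>. f \<tau> * cis (- l * \<tau>)) =
      integral {-R..R} (\<lambda>\<tau>. f \<tau> * cis (- l * \<tau>))) at_top"
    using eventually_ge_at_top[of 0] by eventually_elim (rule symmetric_integral_split[symmetric])
  from Lim_transform_eventually[OF lim this] show ?thesis by blast
qed

end

section \<open>Truncated inversion integrals on the line of real part one\<close>

text \<open>On this line the inversion integral is a Fourier integral at frequency \<open>ln t\<close>.\<close>

lemma powr_line:
  assumes "t > 0"
  shows "of_real t powr (- Complex 1 \<tau>) = of_real (1 / t) * cis (- ln t * \<tau>)"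
proof -
  have "of_real t powr (- Complex 1 \<tau>) = exp (- Complex 1 \<tau> * of_real (ln t))"
    using assms by (simp add: powr_def Ln_of_real)
  also have "\<dots> = of_real (exp (- ln t)) * cis (- ln t * \<tau>)"
    by (simp add: exp_eq_polar mult.commute)
  also have "exp (- ln t) = 1 / t" using assms by (simp add: exp_minus field_simps)
  finally show ?thesis .
qed

context meijer_parameters
begin

definition line_symbol :: "real \<Rightarrow> complex" where
  "line_symbol \<tau> = gamma_quotient (Complex 1 \<tau>)"

text \<open>The inversion integral over the segment from \<open>1 - iR\<close> to \<open>1 + iR\<close>. The abscissa \<open>1\<close> is admissible
  for all nonnegative parameters.\<close>

definition bromwich :: "real \<Rightarrow> real \<Rightarrow> complex" where
  "bromwich R t = 1 / (2 * of_real pi) *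
     integral {-R..R} (\<lambda>\<tau>. line_symbol \<tau> * of_real t powr (- Complex 1 \<tau>))"

abbreviation line_symbol_deriv :: "real \<Rightarrow> complex" where
  "line_symbol_deriv \<tau> \<equiv> - \<i> * (line_symbol \<tau> * digamma_excess (Complex 1 \<tau>))"

lemma continuous_on_gamma_quotient: "continuous_on {s. Re s > 0} gamma_quotient"
  using has_field_derivative_gamma_quotient by (intro continuous_at_imp_continuous_on ballI) (auto intro: DERIV_isCont)

lemma continuous_on_digamma_excess: "continuous_on {s. Re s > 0} digamma_excess"
  unfolding digamma_excess_def[abs_def]
  by (intro continuous_at_imp_continuous_on ballI continuous_sum continuous_diff isCont_Polygamma continuous_intros)
     (use right_half_plane_Ints in auto)

lemma symbol_with_decay_line_symbol:
  obtains C where "symbol_with_decay line_symbol line_symbol_deriv C decay"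
proof -
  obtain C1 where C1: "C1 \<ge> 0" "\<And>s. Re s \<ge> 1 \<Longrightarrow> norm (gamma_quotient s) \<le> C1 * norm s powr (- decay)"
    using gamma_quotient_bound by blast
  obtain C2 where C2: "C2 \<ge> 0" "\<And>s. Re s \<ge> 1 \<Longrightarrow> norm (digamma_excess s) \<le> C2 / norm s"
    using digamma_excess_bound by blast
  show ?thesis
  proof (rule that[of "C1 + C1 * C2"], unfold_locales)
    have cC: "continuous_on UNIV (\<lambda>\<tau>. Complex 1 \<tau>)"
      unfolding Complex_eq by (intro continuous_intros)
    show "continuous_on UNIV line_symbol_deriv"
      unfolding line_symbol_def
      by (intro continuous_intros continuous_on_compose2[OF continuous_on_gamma_quotient cC]
            continuous_on_compose2[OF continuous_on_digamma_excess cC]) auto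
    fix \<tau> :: real
    have "(Complex 1 has_vector_derivative \<i>) (at \<tau>)"
      unfolding Complex_eq[abs_def] by (auto intro!: derivative_eq_intros)
    from field_vector_diff_chain_at[OF this has_field_derivative_gamma_quotient]
    show "(line_symbol has_vector_derivative - \<i> * (line_symbol \<tau> * digamma_excess (Complex 1 \<tau>))) (at \<tau>)"
      by (simp add: line_symbol_def[abs_def] o_def mult_ac)
    assume \<tau>: "\<tau> \<noteq> 0"
    have cm: "norm (Complex 1 \<tau>) \<ge> \<bar>\<tau>\<bar>" using abs_Im_le_cmod[of "Complex 1 \<tau>"] by simp
    have gq: "norm (line_symbol \<tau>) \<le> C1 * \<bar>\<tau>\<bar> powr (- decay)"
    proof -
      have "norm (Complex 1 \<tau>) powr (- decay) \<le> \<bar>\<tau>\<bar> powr (- decay)"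
        using cm \<tau> decay by (intro powr_mono2') auto
      from mult_left_mono[OF this C1(1)] show ?thesis
        using C1(2)[of "Complex 1 \<tau>"] unfolding line_symbol_def by simp
    qed
    also have "\<dots> \<le> (C1 + C1 * C2) * \<bar>\<tau>\<bar> powr (- decay)"
      using C1(1) C2(1) by (intro mult_right_mono) auto
    finally show "norm (line_symbol \<tau>) \<le> (C1 + C1 * C2) * \<bar>\<tau>\<bar> powr (- decay)" .
    have "norm (digamma_excess (Complex 1 \<tau>)) \<le> C2 / norm (Complex 1 \<tau>)"
      using C2(2)[of "Complex 1 \<tau>"] by simp
    also have "\<dots> \<le> C2 / \<bar>\<tau>\<bar>" using C2(1) cm \<tau> by (intro divide_left_mono mult_pos_pos) auto
    finally have "norm (line_symbol \<tau> * digamma_excess (Complex 1 \<tau>)) \<le>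
        (C1 * \<bar>\<tau>\<bar> powr (- decay)) * (C2 / \<bar>\<tau>\<bar>)"
      unfolding norm_mult using gq C1(1) by (intro mult_mono) auto
    also have "\<dots> = C1 * C2 * \<bar>\<tau>\<bar> powr (- decay - 1)"
      using \<tau> by (simp add: powr_diff)
    also have "\<dots> \<le> (C1 + C1 * C2) * \<bar>\<tau>\<bar> powr (- decay - 1)"
      using C1(1) by (intro mult_right_mono) auto
    finally show "norm (- \<i> * (line_symbol \<tau> * digamma_excess (Complex 1 \<tau>))) \<le>
        (C1 + C1 * C2) * \<bar>\<tau>\<bar> powr (- decay - 1)"
      by (simp add: norm_mult)
  qed (use C1(1) C2(1) decay in auto)
qed

lemma bromwich_eq_fourier:
  assumes "t > 0"
  shows "bromwich R t = of_real (1 / (2 * pi * t)) *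
    integral {-R..R} (\<lambda>\<tau>. line_symbol \<tau> * cis (- ln t * \<tau>))"
proof -
  have "integral {-R..R} (\<lambda>\<tau>. line_symbol \<tau> * of_real t powr (- Complex 1 \<tau>)) =
      integral {-R..R} (\<lambda>\<tau>. of_real (1 / t) * (line_symbol \<tau> * cis (- ln t * \<tau>)))"
    unfolding powr_line[OF assms] by (simp add: mult_ac)
  also have "\<dots> = of_real (1 / t) * integral {-R..R} (\<lambda>\<tau>. line_symbol \<tau> * cis (- ln t * \<tau>))"
    by (rule integral_mult_right)
  finally show ?thesis by (simp add: bromwich_def)
qed

text \<open>This is the majorant for dominated convergence: for \<open>decay > 0\<close> the singularity
  at \<open>t = 1\<close> is integrable, although the inversion integral need not converge absolutely.\<close>

lemma bromwich_bound:
  obtains D where "D \<ge> 0"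
    and "\<And>R t. R \<ge> 0 \<Longrightarrow> t > 0 \<Longrightarrow> t \<noteq> 1 \<Longrightarrow> norm (bromwich R t) \<le> D / t * \<bar>ln t\<bar> powr (decay - 1)"
proof -
  obtain C where "symbol_with_decay line_symbol line_symbol_deriv C decay"
    using symbol_with_decay_line_symbol by blast
  then interpret symbol_with_decay line_symbol line_symbol_deriv C decay .
  define D where "D = 2 * (C * (1 / (1 - decay) + 2 + 1 / decay))"
  have D: "D \<ge> 0" using C decay by (simp add: D_def)
  show ?thesis
  proof (rule that[of "D / (2 * pi)"])
    fix R t :: real assume "R \<ge> 0" "t > 0" "t \<noteq> 1"
    then show "norm (bromwich R t) \<le> D / (2 * pi) / t * \<bar>ln t\<bar> powr (decay - 1)"
      using symmetric_bound[of R "ln t"] by (simp add: bromwich_eq_fourier norm_mult D_def norm_divide field_simps)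
  qed (use D in simp)
qed

lemma bromwich_convergent:
  assumes "t > 0" "t \<noteq> 1"
  shows "\<exists>L. ((\<lambda>R. bromwich R t) \<longlongrightarrow> L) at_top"
proof -
  obtain C where "symbol_with_decay line_symbol line_symbol_deriv C decay"
    using symbol_with_decay_line_symbol by blast
  then interpret symbol_with_decay line_symbol line_symbol_deriv C decay .
  obtain L where "((\<lambda>R. integral {-R..R} (\<lambda>\<tau>. line_symbol \<tau> * cis (- ln t * \<tau>))) \<longlongrightarrow> L) at_top"
    using symmetric_convergent[of "ln t"] assms by auto
  from tendsto_mult_left[OF this] show ?thesis
    unfolding bromwich_eq_fourier[OF assms(1)] by blast
qed

text \<open>The truncated form of \<open>- \<phi>' = \<phi> Q\<close> on the side of functions, with its boundary term.\<close>

lemma bromwich_by_parts: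
  assumes "t > 0" "R \<ge> 0"
  shows "of_real (ln (1 / t)) * bromwich R t =
    1 / (2 * of_real pi) * integral {-R..R} (\<lambda>\<tau>. line_symbol \<tau> * digamma_excess (Complex 1 \<tau>) *
      of_real t powr (- Complex 1 \<tau>)) +
    of_real (1 / (2 * pi * t)) * (line_symbol R * cis (- ln t * R) - line_symbol (- R) * cis (ln t * R)) / \<i>"
proof -
  obtain C where "symbol_with_decay line_symbol line_symbol_deriv C decay"
    using symbol_with_decay_line_symbol by blast
  then interpret symbol_with_decay line_symbol line_symbol_deriv C decay .
  define I where "I = integral {-R..R} (\<lambda>\<tau>. line_symbol \<tau> * cis (- ln t * \<tau>))"
  define J where "J = integral {-R..R} (\<lambda>\<tau>. line_symbol \<tau> * digamma_excess (Complex 1 \<tau>) * cis (- ln t * \<tau>))"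
  define B where "B = line_symbol R * cis (- ln t * R) - line_symbol (- R) * cis (ln t * R)"
  have "integral {-R..R} (\<lambda>\<tau>. - \<i> * (line_symbol \<tau> * digamma_excess (Complex 1 \<tau>)) * cis (- ln t * \<tau>)) = - \<i> * J"
    unfolding J_def mult.assoc by (rule integral_mult_right)
  then have "\<i> * of_real (ln t) * I = - \<i> * J - B"
    using oscillatory_by_parts[OF deriv cont', of "-R" R "ln t"] assms by (simp add: I_def B_def)
  note by_parts = this
  have "- (of_real (ln t) * I) = \<i> * (\<i> * of_real (ln t) * I)" by (simp add: mult.assoc)
  also have "\<dots> = J + B / \<i>" unfolding by_parts by (simp add: right_diff_distrib mult.assoc)
  finally have "- (of_real (ln t) * I) = J + B / \<i>" .
  moreover have "of_real (ln (1 / t)) * bromwich R t = of_real (1 / (2 * pi * t)) * (- (of_real (ln t) * I))"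
    unfolding bromwich_eq_fourier[OF assms(1)] I_def[symmetric] using assms by (simp add: ln_div)
  moreover have "integral {-R..R} (\<lambda>\<tau>. line_symbol \<tau> * digamma_excess (Complex 1 \<tau>) * of_real t powr (- Complex 1 \<tau>)) =
      of_real (1 / t) * J"
    unfolding powr_line[OF assms(1)] J_def integral_mult_right[symmetric] by (simp add: mult_ac)
  ultimately show ?thesis
    unfolding B_def[symmetric] by (simp add: diff_divide_distrib)
qed

lemma line_symbol_tendsto_0: "(line_symbol \<longlongrightarrow> 0) at_top" "((\<lambda>R. line_symbol (- R)) \<longlongrightarrow> 0) at_top"
proof -
  obtain C where "symbol_with_decay line_symbol line_symbol_deriv C decay"
    using symbol_with_decay_line_symbol by blast
  then interpret symbol_with_decay line_symbol line_symbol_deriv C decay .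
  have lim: "((\<lambda>R. C * R powr (- decay)) \<longlongrightarrow> 0) at_top"
    using decay by (intro tendsto_mult_right_zero tendsto_neg_powr filterlim_ident) auto
  have "norm (line_symbol R) \<le> C * R powr (- decay)" "norm (line_symbol (- R)) \<le> C * R powr (- decay)"
    if "R > 0" for R
    using that bound[of R] bound[of "- R"] by simp_all
  then have "\<forall>\<^sub>F R in at_top. norm (line_symbol R) \<le> C * R powr (- decay)"
    "\<forall>\<^sub>F R in at_top. norm (line_symbol (- R)) \<le> C * R powr (- decay)"
    by (intro eventually_mono[OF eventually_gt_at_top[of 0]]; simp)+
  from this[THEN Lim_null_comparison, OF lim]
  show "(line_symbol \<longlongrightarrow> 0) at_top" "((\<lambda>R. line_symbol (- R)) \<longlongrightarrow> 0) at_top" .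
qed

end

section \<open>Shifting the line of integration\<close>

lemma norm_of_real_powr:
  assumes "z > 0"
  shows "norm (of_real z powr (- s)) = z powr (- Re s)"
  using norm_powr_real_powr[of "of_real z" "- s"] assms by simp

lemma closed_segment_horizontal:
  "closed_segment (Complex c y) (Complex c' y) \<subseteq> {s. Im s = y \<and> min c c' \<le> Re s \<and> Re s \<le> max c c'}"
proof -
  have eq: "{s. Im s = y \<and> min c c' \<le> Re s \<and> Re s \<le> max c c'} =
      ({s. Im s \<le> y} \<inter> {s. Im s \<ge> y}) \<inter> ({s. Re s \<ge> min c c'} \<inter> {s. Re s \<le> max c c'})"
    by auto
  have "convex {s. Im s = y \<and> min c c' \<le> Re s \<and> Re s \<le> max c c'}"
    unfolding eq by (intro convex_Int convex_halfspace_Re_ge convex_halfspace_Re_le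
      convex_halfspace_Im_ge convex_halfspace_Im_le)
  then show ?thesis by (intro closed_segment_subset) auto
qed

lemma powr_between:
  fixes z c c' x :: real
  assumes "z > 0" "min c c' \<le> x" "x \<le> max c c'"
  shows "z powr (- x) \<le> z powr (- c) + z powr (- c')"
proof -
  have "z powr (- min c c') \<le> z powr (- c) + z powr (- c')"
    "z powr (- max c c') \<le> z powr (- c) + z powr (- c')"
    by (simp_all add: min_def max_def)
  moreover have "z powr (- x) \<le> z powr (- min c c')" if "z \<ge> 1"
    using assms that by (intro powr_mono) auto
  moreover have "z powr (- x) \<le> z powr (- max c c')" if "z < 1"
    using assms that by (intro powr_mono') auto
  ultimately show ?thesis by linarith
qed

context meijer_parameters
begin

lemma meijer_kernel_eq: "meijer_kernel p b a z s = gamma_quotient s * of_real z powr (- s)"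
  by (simp add: meijer_kernel_def gamma_quotient_def)

definition left_edge :: real where
  "left_edge = - Min (a ` {1..p})"

lemma left_edge_le: "k \<in> {1..p} \<Longrightarrow> - a k \<le> left_edge"
  by (auto simp: left_edge_def)

lemma left_edge_nonpos: "left_edge \<le> 0"
  using a_nonneg p_pos by (auto simp: left_edge_def)

text \<open>The reciprocal Gamma function is entire, so only the poles of the numerator matter; they all lie
  at or to the left of the edge.\<close>

lemma meijer_kernel_holomorphic:
  assumes "z > 0"
  shows "meijer_kernel p b a z holomorphic_on {s. Re s > left_edge}"
proof -
  let ?S = "{s. Re s > left_edge}"
  have "(\<lambda>s. (\<Prod>k=1..p. Gamma (of_real (a k) + s)) * (\<Prod>k=1..p. rGamma (of_real (b k) + s)) *
      of_real z powr (- s)) holomorphic_on ?S"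
  proof (intro holomorphic_intros)
    fix k s assume k: "k \<in> {1..p}" and s: "s \<in> ?S"
    have "Re (of_real (a k) + s) > 0" using left_edge_le[OF k] s by simp
    then show "of_real (a k) + s \<notin> \<int>\<^sub>\<le>\<^sub>0"
      using nonpos_Ints_subset_nonpos_Reals by (auto simp: complex_nonpos_Reals_iff)
  qed
  then show ?thesis
    by (simp add: meijer_kernel_def[abs_def] rGamma_inverse_Gamma prod_inversef[unfolded o_def] divide_inverse)
qed

lemma meijer_kernel_primitive:
  assumes "z > 0"
  obtains F where
    "\<And>s. Re s > left_edge \<Longrightarrow> (F has_field_derivative meijer_kernel p b a z s) (at s)"
proof -
  let ?S = "{s. Re s > left_edge}"
  have op: "open ?S" by (rule open_halfspace_Re_gt)
  obtain F where "\<And>s. s \<in> ?S \<Longrightarrow> (F has_field_derivative meijer_kernel p b a z s) (at s within ?S)"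
    using holomorphic_convex_primitive'[OF convex_halfspace_Re_gt op meijer_kernel_holomorphic[OF assms]] by blast
  then show ?thesis using that op by (metis at_within_open mem_Collect_eq)
qed

definition line_integral :: "real \<Rightarrow> real \<Rightarrow> real \<Rightarrow> complex" where
  "line_integral z c R = contour_integral (linepath (Complex c (- R)) (Complex c R)) (meijer_kernel p b a z)"

lemma bromwich_eq_line_integral:
  assumes "R > 0"
  shows "bromwich R z = 1 / (2 * of_real pi * \<i>) * line_integral z 1 R"
  unfolding line_integral_def bromwich_def line_symbol_def meijer_kernel_eq
  using assms by (subst contour_integral_linepath_same_Re[of _ 1 _ "-R" R]) auto

text \<open>Cauchy's theorem for a rectangle, in the form of a primitive: the two vertical integrals differ
  by the increments of the primitive along the two horizontal sides.\<close>

lemma line_integral_shift: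
  assumes z: "z > 0" and R: "R \<ge> 0" and c: "c > left_edge" "c' > left_edge"
    and bnd: "\<And>s. \<bar>Im s\<bar> = R \<Longrightarrow> min c c' \<le> Re s \<Longrightarrow> Re s \<le> max c c' \<Longrightarrow>
      norm (meijer_kernel p b a z s) \<le> B"
  shows "norm (line_integral z c' R - line_integral z c R) \<le> 2 * B * \<bar>c' - c\<bar>"
proof -
  obtain F where F: "\<And>s. Re s > left_edge \<Longrightarrow> (F has_field_derivative meijer_kernel p b a z s) (at s)"
    using meijer_kernel_primitive[OF z] by blast
  have V: "line_integral z d R = F (Complex d R) - F (Complex d (- R))" if "d > left_edge" for d
  proof -
    have "closed_segment (Complex d (- R)) (Complex d R) \<subseteq> {s. Re s > left_edge}"
      using that by (intro closed_segment_subset convex_halfspace_Re_gt) auto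
    moreover have "(F has_field_derivative meijer_kernel p b a z s) (at s within {s. Re s > left_edge})"
      if "s \<in> {s. Re s > left_edge}" for s
      using F[of s] that by (simp add: has_field_derivative_at_within)
    ultimately have "(meijer_kernel p b a z has_contour_integral
        (F (pathfinish (linepath (Complex d (- R)) (Complex d R))) -
         F (pathstart (linepath (Complex d (- R)) (Complex d R))))) (linepath (Complex d (- R)) (Complex d R))"
      by (intro contour_integral_primitive[of "{s. Re s > left_edge}"]) simp_all
    then show ?thesis unfolding line_integral_def by (simp add: contour_integral_unique)
  qed
  have H: "norm (F (Complex c' y) - F (Complex c y)) \<le> B * \<bar>c' - c\<bar>" if "\<bar>y\<bar> = R" for y
  proof -
    have "norm (F (Complex c' y) - F (Complex c y)) \<le> B * norm (Complex c' y - Complex c y)"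
    proof (rule field_differentiable_bound[of "closed_segment (Complex c y) (Complex c' y)" F "meijer_kernel p b a z"])
      fix s assume "s \<in> closed_segment (Complex c y) (Complex c' y)"
      then have s: "Im s = y" "min c c' \<le> Re s" "Re s \<le> max c c'" using closed_segment_horizontal[of c y c'] by auto
      then have "Re s > left_edge" using c by linarith
      from F[OF this] show "(F has_field_derivative meijer_kernel p b a z s)
          (at s within closed_segment (Complex c y) (Complex c' y))"
        by (rule has_field_derivative_at_within)
      show "norm (meijer_kernel p b a z s) \<le> B" using s that by (intro bnd) simp_all
    qed simp_all
    also have "norm (Complex c' y - Complex c y) = \<bar>c' - c\<bar>" by (simp add: cmod_def)
    finally show ?thesis .
  qed
  have "line_integral z c' R - line_integral z c R =
      (F (Complex c' R) - F (Complex c R)) - (F (Complex c' (-R)) - F (Complex c (-R)))"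
    using c by (simp add: V)
  also have "norm \<dots> \<le> B * \<bar>c' - c\<bar> + B * \<bar>c' - c\<bar>"
    using R by (intro order_trans[OF norm_triangle_ineq4] add_mono H) simp_all
  finally show ?thesis by (simp add: mult_ac)
qed

lemma line_integral_shift_tendsto_0:
  assumes "z > 0" "c > left_edge" "c' > left_edge"
  shows "((\<lambda>R. line_integral z c' R - line_integral z c R) \<longlongrightarrow> 0) at_top"
proof -
  obtain N where N: "real N \<ge> 1 - min c c'" using real_arch_simple by blast
  obtain D where D: "D \<ge> 0" "\<And>s. Re s \<ge> 1 - real N \<Longrightarrow> \<bar>Im s\<bar> \<ge> 1 \<Longrightarrow>
      norm (gamma_quotient s) \<le> D * \<bar>Im s\<bar> powr (- decay)"
    using gamma_quotient_bound_strip by blast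
  define E where "E = z powr (- c) + z powr (- c')"
  have "norm (line_integral z c' R - line_integral z c R) \<le> 2 * (D * R powr (- decay) * E) * \<bar>c' - c\<bar>"
    if R: "R \<ge> 1" for R
  proof (rule line_integral_shift)
    fix s assume s: "\<bar>Im s\<bar> = R" "min c c' \<le> Re s" "Re s \<le> max c c'"
    show "norm (meijer_kernel p b a z s) \<le> D * R powr (- decay) * E"
      unfolding meijer_kernel_eq norm_mult norm_of_real_powr[OF assms(1)] E_def
      using D(2)[of s] s R N assms(1) D(1) by (intro mult_mono powr_between) auto
  qed (use assms R in auto)
  then have ev: "\<forall>\<^sub>F R in at_top. norm (line_integral z c' R - line_integral z c R) \<le>
      2 * (D * R powr (- decay) * E) * \<bar>c' - c\<bar>"
    by (intro eventually_mono[OF eventually_ge_at_top[of 1]])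
  have "((\<lambda>R. 2 * (D * R powr (- decay) * E) * \<bar>c' - c\<bar>) \<longlongrightarrow> 2 * (D * 0 * E) * \<bar>c' - c\<bar>) at_top"
    using decay by (intro tendsto_intros tendsto_neg_powr filterlim_ident) auto
  with ev show ?thesis by (intro Lim_null_comparison[OF ev]) simp
qed

text \<open>Since every admissible line gives the same limit, the description that defines \<open>meijer_G\<close> has
  exactly one solution.\<close>

lemma bromwich_tendsto_meijer_G:
  assumes "0 < z" "z < 1"
  shows "((\<lambda>R. bromwich R z) \<longlongrightarrow> meijer_G p b a z) at_top"
proof -
  obtain L where L: "((\<lambda>R. bromwich R z) \<longlongrightarrow> L) at_top"
    using bromwich_convergent[of z] assms by auto
  have L1: "((\<lambda>R. 1 / (2 * of_real pi * \<i>) * line_integral z 1 R) \<longlongrightarrow> L) at_top"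
    by (rule Lim_transform_eventually[OF L])
       (use eventually_gt_at_top[of 0] in eventually_elim, rule bromwich_eq_line_integral)
  have lim: "((\<lambda>R. 1 / (2 * of_real pi * \<i>) * line_integral z c R) \<longlongrightarrow> L) at_top" if "c > left_edge" for c
  proof -
    have "((\<lambda>R. 1 / (2 * of_real pi * \<i>) * (line_integral z c R - line_integral z 1 R)) \<longlongrightarrow>
        1 / (2 * of_real pi * \<i>) * 0) at_top"
      using that left_edge_nonpos assms
      by (intro tendsto_mult_left line_integral_shift_tendsto_0) auto
    from tendsto_add[OF this L1] show ?thesis by (simp add: algebra_simps)
  qed
  have "meijer_G p b a z = L"
    unfolding meijer_G_def left_edge_def[symmetric] line_integral_def[symmetric]
  proof (rule the_equality)
    show "\<forall>c>left_edge. ((\<lambda>R. 1 / (2 * of_real pi * \<i>) * line_integral z c R) \<longlongrightarrow> L) at_top"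
      using lim by blast
    fix L' assume "\<forall>c>left_edge. ((\<lambda>R. 1 / (2 * of_real pi * \<i>) * line_integral z c R) \<longlongrightarrow> L') at_top"
    moreover have "(1::real) > left_edge" using left_edge_nonpos by simp
    ultimately show "L' = L" using L1 tendsto_unique[OF trivial_limit_at_top_linorder] by blast
  qed
  with L show ?thesis by simp
qed

text \<open>The rectangle may extend far to the right. If its width grows like \<open>R powr (decay / 2)\<close>, the
  horizontal sides still contribute a negative power of \<open>R\<close>, while the factor \<open>z powr (- Re s)\<close>
  makes the right side decay faster than its length \<open>2 * R\<close> grows.\<close>

lemma bromwich_tendsto_0:
  assumes "z > 1"
  shows "((\<lambda>R. bromwich R z) \<longlongrightarrow> 0) at_top"
proof -
  obtain C where C: "C \<ge> 0" "\<And>s. Re s \<ge> 1 \<Longrightarrow> norm (gamma_quotient s) \<le> C * norm s powr (- decay)"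
    using gamma_quotient_bound by blast
  have ker: "norm (meijer_kernel p b a z s) \<le> C * r powr (- decay) * z powr (- \<sigma>)"
    if "1 \<le> Re s" "0 < r" "r \<le> norm s" "\<sigma> \<le> Re s" for s r \<sigma>
  proof -
    have "C * norm s powr (- decay) \<le> C * r powr (- decay)"
      using that C(1) decay by (intro mult_left_mono powr_mono2') auto
    moreover have "z powr (- Re s) \<le> z powr (- \<sigma>)" using assms that by (intro powr_mono) auto
    ultimately show ?thesis
      unfolding meijer_kernel_eq norm_mult using C(2)[OF that(1)] C(1) assms
      by (subst norm_of_real_powr) (auto intro!: mult_mono intro: order_trans)
  qed
  define T where "T R = 1 + R powr (decay / 2)" for R :: real
  have bnd: "norm (line_integral z 1 R) \<le>
      2 * (C * R powr (- decay)) * R powr (decay / 2) + C * z powr (- T R) * (2 * R)"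
    if R: "R \<ge> 1" for R
  proof -
    have T: "T R \<ge> 1" by (simp add: T_def)
    have "norm (line_integral z 1 R - line_integral z (T R) R) \<le> 2 * (C * R powr (- decay)) * \<bar>1 - T R\<bar>"
    proof (rule line_integral_shift)
      fix s assume s: "\<bar>Im s\<bar> = R" "min (T R) 1 \<le> Re s" "Re s \<le> max (T R) 1"
      have "norm (meijer_kernel p b a z s) \<le> C * R powr (- decay) * z powr (- 0)"
        using s R T abs_Im_le_cmod[of s] by (intro ker) auto
      then show "norm (meijer_kernel p b a z s) \<le> C * R powr (- decay)" using assms by simp
    qed (use assms R T left_edge_nonpos in auto)
    moreover have "norm (line_integral z (T R) R) \<le> C * z powr (- T R) * norm (Complex (T R) R - Complex (T R) (- R))"
      unfolding line_integral_def
    proof (rule contour_integral_bound_linepath)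
      have cont: "continuous_on {s. Re s > left_edge} (meijer_kernel p b a z)"
      proof -
        have "meijer_kernel p b a z holomorphic_on {s. Re s > left_edge}"
          using meijer_kernel_holomorphic assms by simp
        then show ?thesis by (rule holomorphic_on_imp_continuous_on)
      qed
      show "meijer_kernel p b a z contour_integrable_on linepath (Complex (T R) (- R)) (Complex (T R) R)"
        using T left_edge_nonpos
        by (intro contour_integrable_continuous_linepath continuous_on_subset[OF cont] closed_segment_subset
              convex_halfspace_Re_gt) auto
      fix s assume "s \<in> closed_segment (Complex (T R) (- R)) (Complex (T R) R)"
      moreover have "closed_segment (Complex (T R) (- R)) (Complex (T R) R) \<subseteq> {s. Re s \<ge> T R}"
        by (intro closed_segment_subset convex_halfspace_Re_ge) auto
      ultimately have s: "Re s \<ge> T R" by blast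
      have "norm (meijer_kernel p b a z s) \<le> C * 1 powr (- decay) * z powr (- T R)"
        using s T complex_Re_le_cmod[of s] by (intro ker) auto
      then show "norm (meijer_kernel p b a z s) \<le> C * z powr (- T R)" by simp
    qed (use C in auto)
    moreover have len: "norm (Complex (T R) R - Complex (T R) (- R)) = 2 * R"
      using R by (simp add: cmod_def real_sqrt_mult)
    moreover have shift: "\<bar>1 - T R\<bar> = R powr (decay / 2)" by (simp add: T_def)
    moreover have "norm (line_integral z 1 R) \<le>
        norm (line_integral z 1 R - line_integral z (T R) R) + norm (line_integral z (T R) R)"
      using norm_triangle_sub by (simp add: add.commute)
    ultimately show ?thesis unfolding len shift by linarith
  qed
  have "((\<lambda>R. R powr (- m) * R powr (m / 2)) \<longlongrightarrow> 0) at_top"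
    and "((\<lambda>R. z powr (- (1 + R powr (m / 2))) * R) \<longlongrightarrow> 0) at_top" if "m > 0" for m :: real
    using that assms by real_asymp+
  from this[OF decay(1)] have "((\<lambda>R. R powr (- decay) * R powr (decay / 2)) \<longlongrightarrow> 0) at_top"
    and "((\<lambda>R. z powr (- T R) * R) \<longlongrightarrow> 0) at_top"
    by (simp_all only: T_def)
  then have "((\<lambda>R. 2 * C * (R powr (- decay) * R powr (decay / 2)) + 2 * C * (z powr (- T R) * R))
      \<longlongrightarrow> 2 * C * 0 + 2 * C * 0) at_top"
    by (intro tendsto_add tendsto_mult_left)
  then have "((\<lambda>R. 2 * (C * R powr (- decay)) * R powr (decay / 2) + C * z powr (- T R) * (2 * R)) \<longlongrightarrow> 0) at_top"
    by (simp add: mult_ac)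
  moreover have "\<forall>\<^sub>F R in at_top. norm (line_integral z 1 R) \<le>
      2 * (C * R powr (- decay)) * R powr (decay / 2) + C * z powr (- T R) * (2 * R)"
    using bnd by (intro eventually_mono[OF eventually_ge_at_top[of 1]])
  ultimately have "((\<lambda>R. line_integral z 1 R) \<longlongrightarrow> 0) at_top"
    by (rule Lim_null_comparison[rotated])
  from tendsto_mult_left[OF this, of "1 / (2 * of_real pi * \<i>)"]
  have "((\<lambda>R. 1 / (2 * of_real pi * \<i>) * line_integral z 1 R) \<longlongrightarrow> 0) at_top" by simp
  then show ?thesis
    by (rule Lim_transform_eventually)
       (use eventually_gt_at_top[of 0] in eventually_elim, rule bromwich_eq_line_integral[symmetric])
qed

end

section \<open>The Mellin transform of the convolution kernel\<close>

lemma set_integrable_powr_tail: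
  fixes x r :: real
  assumes x: "x > 0" and r: "r > 0"
  shows "set_integrable lborel {x<..} (\<lambda>t. t powr (- r - 1))"
proof -
  have "set_integrable lborel (einterval (ereal x) \<infinity>) (\<lambda>t. t powr (- r - 1))"
  proof (rule interval_integral_FTC_nonneg(1)[where F = "\<lambda>t. - (t powr (- r)) / r"
        and A = "- (x powr (- r)) / r" and B = "0"])
    fix t assume t: "ereal x < ereal t"
    then show "((\<lambda>t. - (t powr (- r)) / r) has_real_derivative t powr (- r - 1)) (at t)"
      using x r by (auto intro!: derivative_eq_intros)
    show "isCont (\<lambda>t. t powr (- r - 1)) t" using t x by (intro continuous_intros) auto
  next
    have "((\<lambda>t. - (t powr (- r)) / r) \<longlongrightarrow> - (x powr (- r)) / r) (at_right x)"
      using x r by (intro tendsto_intros) auto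
    then show "(((\<lambda>t. - (t powr (- r)) / r) \<circ> real_of_ereal) \<longlongrightarrow> - (x powr (- r)) / r) (at_right (ereal x))"
      by (simp add: ereal_tendsto_simps)
    have "((\<lambda>t. - (t powr (- r)) / r) \<longlongrightarrow> - 0 / r) at_top"
      using r by (intro tendsto_intros tendsto_neg_powr filterlim_ident) auto
    then show "(((\<lambda>t. - (t powr (- r)) / r) \<circ> real_of_ereal) \<longlongrightarrow> 0) (at_left \<infinity>)"
      by (simp add: ereal_tendsto_simps)
  qed auto
  then show ?thesis by simp
qed

lemma has_bochner_integral_powr_tail:
  fixes x :: real and w :: complex
  assumes x: "x > 0" and w: "Re w > 0"
  shows "has_bochner_integral lborel
    (\<lambda>t. indicator {x<..} t *\<^sub>R (of_real x powr w * of_real t powr (- w - 1))) (1 / w)"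
proof -
  let ?f = "\<lambda>t. of_real x powr w * of_real t powr (- w - 1)"
  have int: "set_integrable lborel {x<..} ?f"
    unfolding set_integrable_def
  proof (rule Bochner_Integration.integrable_bound)
    show "integrable lborel (\<lambda>t. x powr Re w * (indicator {x<..} t *\<^sub>R t powr (- Re w - 1)))"
      using set_integrable_powr_tail[OF x w] unfolding set_integrable_def by (rule integrable_mult_right)
    have "continuous_on {x<..} ?f" using x by (intro continuous_intros) auto
    then show "(\<lambda>t. indicator {x<..} t *\<^sub>R ?f t) \<in> borel_measurable lborel"
      using borel_measurable_continuous_on_indicator[of "{x<..}" ?f] by simp
    have "norm (?f t) = x powr Re w * t powr (- Re w - 1)" if "t > x" for t
      using that x by (simp add: norm_mult norm_powr_real_powr)
    then show "AE t in lborel. norm (indicator {x<..} t *\<^sub>R ?f t) \<le>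
        norm (x powr Re w * (indicator {x<..} t *\<^sub>R t powr (- Re w - 1)))"
      by (intro AE_I2) (auto simp: indicator_def)
  qed
  let ?F = "\<lambda>t::real. - (of_real x powr w * of_real t powr (- w) / w)"
  have "(LBINT t=ereal x..\<infinity>. ?f t) = 0 - (- (1 / w))"
  proof (rule interval_integral_FTC_integrable[where F = ?F])
    fix t assume t: "ereal x < ereal t"
    have "((\<lambda>z. - (of_real x powr w * z powr (- w) / w)) has_field_derivative ?f t) (at (of_real t))"
      using x w t by (auto intro!: derivative_eq_intros simp: complex_nonpos_Reals_iff)
    then show "(?F has_vector_derivative ?f t) (at t)"
      by (rule has_vector_derivative_real_field)
    show "isCont ?f t" using x t by (intro continuous_intros) auto
  next
    show "set_integrable lborel (einterval (ereal x) \<infinity>) ?f" using int by simp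
    have "isCont ?F x" using x by (intro continuous_intros) (use w in auto)
    then have "(?F \<longlongrightarrow> ?F x) (at x)" by (simp add: isCont_def)
    then have "(?F \<longlongrightarrow> ?F x) (at_right x)" by (rule tendsto_within_subset) simp
    moreover have "?F x = - (1 / w)"
      using x by (simp add: powr_minus)
    ultimately show "((?F \<circ> real_of_ereal) \<longlongrightarrow> - (1 / w)) (at_right (ereal x))"
      by (simp add: ereal_tendsto_simps)
    have lim: "((\<lambda>t. x powr Re w * t powr (- Re w) / norm w) \<longlongrightarrow> x powr Re w * 0 / norm w) at_top"
      using w by (intro tendsto_intros tendsto_neg_powr filterlim_ident) auto
    have "(?F \<longlongrightarrow> 0) at_top"
    proof (rule Lim_null_comparison)
      show "\<forall>\<^sub>F t in at_top. norm (?F t) \<le> x powr Re w * t powr (- Re w) / norm w"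
        using eventually_gt_at_top[of 0]
        by eventually_elim (use x in \<open>simp add: norm_mult norm_divide norm_powr_real_powr\<close>)
    qed (use lim in simp)
    then show "((?F \<circ> real_of_ereal) \<longlongrightarrow> 0) (at_left \<infinity>)" by (simp add: ereal_tendsto_simps)
  qed auto
  then have "(LBINT t:{x<..}. ?f t) = 1 / w"
    by (simp add: interval_integral_to_infinity_eq)
  then show ?thesis
    using int unfolding has_bochner_integral_iff set_integrable_def set_lebesgue_integral_def by blast
qed

lemma powr_tail_term:
  assumes "x > 0" "t > 0"
  shows "of_real x powr (- s) * (of_real x powr (of_real r + s) * of_real t powr (- (of_real r + s) - 1)) =
    of_real ((x / t) powr r / t) * of_real t powr (- s :: complex)"
proof -
  have "of_real x powr (of_real r + s) = of_real (x powr r) * of_real x powr s"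
    using assms by (simp add: powr_add powr_of_real)
  moreover have "of_real t powr (- (of_real r + s) - 1) = of_real (t powr (- r)) * of_real t powr (- s) / of_real t"
  proof -
    have "of_real t powr (- (of_real r + s) - 1) = of_real t powr (of_real (- r)) * of_real t powr (- s) / (of_real t :: complex)"
      using assms by (simp add: powr_add powr_diff powr_minus field_simps)
    then show ?thesis using assms by (simp add: powr_of_real del: of_real_minus)
  qed
  moreover have "of_real x powr (- s) * of_real x powr s = (1::complex)"
    using assms by (simp add: powr_minus)
  ultimately show ?thesis
    using assms by (simp add: powr_divide powr_minus field_simps)
qed

text \<open>The expansion \<open>1 / (t - x) = \<Sum> (x / t)\<^sup>n / t\<close>, integrated term by term, produces the partial
  fraction series of the digamma function. For \<open>c \<le> d\<close> all differences of powers are nonnegative, so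
  the norms of the terms are the same terms at \<open>Re s\<close>, and their integrals form the convergent
  series at that real point: this justifies the interchange.\<close>

lemma mellin_transform_pair_le:
  fixes c d x :: real and s :: complex
  assumes "0 \<le> c" "c \<le> d" "x > 0" and s: "Re s > 0"
  shows "has_bochner_integral lborel
    (\<lambda>t. indicator {x<..} t *\<^sub>R
       (of_real ((x powr c / t powr c - x powr d / t powr d) / (t - x)) * of_real t powr (- s)))
    (of_real x powr (- s) * (Digamma (of_real d + s) - Digamma (of_real c + s)))"
proof -
  define f where "f s n t = indicator {x<..} t *\<^sub>R
    (of_real (((x / t) powr (c + real n) - (x / t) powr (d + real n)) / t) * of_real t powr (- s))"
    for s :: complex and n :: nat and t
  have int_f: "has_bochner_integral lborel (f s n)
      (of_real x powr (- s) * (1 / (of_real c + s + of_nat n) - 1 / (of_real d + s + of_nat n)))"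
    if "Re s > 0" for s n
  proof -
    have "has_bochner_integral lborel (\<lambda>t. of_real x powr (- s) *
        (indicator {x<..} t *\<^sub>R (of_real x powr (of_real (c + real n) + s) * of_real t powr (- (of_real (c + real n) + s) - 1)) -
         indicator {x<..} t *\<^sub>R (of_real x powr (of_real (d + real n) + s) * of_real t powr (- (of_real (d + real n) + s) - 1))))
      (of_real x powr (- s) * (1 / (of_real (c + real n) + s) - 1 / (of_real (d + real n) + s)))"
      using assms that
      by (intro has_bochner_integral_mult_right has_bochner_integral_diff has_bochner_integral_powr_tail) auto
    also have "(\<lambda>t. of_real x powr (- s) *
        (indicator {x<..} t *\<^sub>R (of_real x powr (of_real (c + real n) + s) * of_real t powr (- (of_real (c + real n) + s) - 1)) -
         indicator {x<..} t *\<^sub>R (of_real x powr (of_real (d + real n) + s) * of_real t powr (- (of_real (d + real n) + s) - 1))))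
      = f s n"
    proof
      fix t
      show "of_real x powr (- s) *
        (indicator {x<..} t *\<^sub>R (of_real x powr (of_real (c + real n) + s) * of_real t powr (- (of_real (c + real n) + s) - 1)) -
         indicator {x<..} t *\<^sub>R (of_real x powr (of_real (d + real n) + s) * of_real t powr (- (of_real (d + real n) + s) - 1)))
        = f s n t"
      proof (cases "x < t")
        case True
        then show ?thesis
          using powr_tail_term[of x t s "c + real n"] powr_tail_term[of x t s "d + real n"] assms
          by (simp only: f_def right_diff_distrib) (simp add: algebra_simps diff_divide_distrib)
      qed (simp add: f_def)
    qed
    finally show ?thesis by (simp add: add_ac)
  qed
  have nz: "of_real e + s \<noteq> 0" if "e \<ge> 0" for e
    using s that by (auto simp: complex_eq_iff)
  \<comment> \<open>The terms are compared with those at the real point \<open>Re s\<close>.\<close>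
  have norm_f: "norm (f s n t) = Re (f (of_real (Re s)) n t)" for n t
  proof (cases "x < t")
    case True
    then have "(x / t) powr (c + real n) \<ge> (x / t) powr (d + real n)"
      using assms by (intro powr_mono') auto
    moreover have "of_real t powr (- of_real (Re s)) = (of_real (t powr (- Re s)) :: complex)"
      using True assms by (subst of_real_minus[symmetric], subst powr_of_real) auto
    ultimately show ?thesis
      using True assms by (simp add: f_def norm_mult norm_powr_real_powr norm_divide flip: of_real_diff)
  qed (simp add: f_def)
  have f_sums: "(\<lambda>n. f s' n t) sums (indicator {x<..} t *\<^sub>R
       (of_real ((x powr c / t powr c - x powr d / t powr d) / (t - x)) * of_real t powr (- s')))" for s' t
  proof (cases "x < t")
    case True
    then have u: "norm (x / t) < 1" using assms by simp
    have "(\<lambda>n. ((x / t) powr c - (x / t) powr d) / t * (x / t) ^ n) sums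
        (((x / t) powr c - (x / t) powr d) / t * (1 / (1 - x / t)))"
      by (intro sums_mult geometric_sums u)
    also have "((x / t) powr c - (x / t) powr d) / t * (1 / (1 - x / t)) =
        (x powr c / t powr c - x powr d / t powr d) / (t - x)"
      using True assms by (simp add: powr_divide field_simps)
    also have "(\<lambda>n. ((x / t) powr c - (x / t) powr d) / t * (x / t) ^ n) =
        (\<lambda>n. ((x / t) powr (c + real n) - (x / t) powr (d + real n)) / t)"
      using True assms by (simp add: fun_eq_iff powr_add powr_realpow field_simps)
    finally have "(\<lambda>n. of_real (((x / t) powr (c + real n) - (x / t) powr (d + real n)) / t) :: complex) sums
        of_real ((x powr c / t powr c - x powr d / t powr d) / (t - x))"
      by (rule sums_of_real)
    from sums_mult2[OF this, of "of_real t powr (- s')"] show ?thesis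
      using True by (simp add: f_def)
  qed (simp add: f_def)
  have int1: "integrable lborel (f s n)" for n
    using int_f[OF s] by (simp add: has_bochner_integral_iff)
  have sum1: "AE t in lborel. summable (\<lambda>n. norm (f s n t))"
    unfolding norm_f by (intro AE_I2 summable_Re sums_summable[OF f_sums])
  have "(\<integral>t. norm (f s n t) \<partial>lborel) =
      Re (of_real x powr (- of_real (Re s)) * (1 / (of_real c + of_real (Re s) + of_nat n) - 1 / (of_real d + of_real (Re s) + of_nat n)))" for n
    unfolding norm_f using int_f[of "of_real (Re s)" n] s by (simp add: has_bochner_integral_iff integral_Re)
  moreover have "summable (\<lambda>n. of_real x powr (- of_real (Re s)) *
      (1 / (of_real c + of_real (Re s) + of_nat n) - 1 / (of_real d + of_real (Re s) + of_nat n)) :: complex)"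
  proof (intro summable_mult sums_summable[OF Digamma_diff_sums])
    have "of_real e + of_real (Re s) \<noteq> (0::complex)" if "e \<ge> 0" for e
      using s that by (simp flip: of_real_add)
    then show "of_real d + of_real (Re s) \<noteq> (0::complex)" "of_real c + of_real (Re s) \<noteq> (0::complex)"
      using assms by auto
  qed
  ultimately have sum2: "summable (\<lambda>n. \<integral>t. norm (f s n t) \<partial>lborel)"
    by (simp only: summable_Re)
  have "(\<lambda>n. integral\<^sup>L lborel (f s n)) sums (\<integral>t. (\<Sum>n. f s n t) \<partial>lborel)"
    by (rule sums_integral[OF int1 sum1 sum2])
  moreover have "(\<lambda>n. integral\<^sup>L lborel (f s n)) sums
      (of_real x powr (- s) * (Digamma (of_real d + s) - Digamma (of_real c + s)))"
    using sums_mult[OF Digamma_diff_sums[of "of_real d + s" "of_real c + s"], of "of_real x powr (- s)"]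
      int_f[OF s] nz assms by (simp add: has_bochner_integral_iff)
  ultimately have "(\<integral>t. (\<Sum>n. f s n t) \<partial>lborel) = of_real x powr (- s) * (Digamma (of_real d + s) - Digamma (of_real c + s))"
    using sums_unique2 by blast
  then show ?thesis
    using integrable_suminf[OF int1 sum1 sum2] by (simp add: has_bochner_integral_iff sums_unique[OF f_sums, symmetric])
qed

lemma mellin_transform_pair:
  fixes c d x :: real and s :: complex
  assumes "0 \<le> c" "0 \<le> d" "x > 0" "Re s > 0"
  shows "has_bochner_integral lborel
    (\<lambda>t. indicator {x<..} t *\<^sub>R
       (of_real ((x powr c / t powr c - x powr d / t powr d) / (t - x)) * of_real t powr (- s)))
    (of_real x powr (- s) * (Digamma (of_real d + s) - Digamma (of_real c + s)))"
proof (cases "c \<le> d")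
  case True
  then show ?thesis using assms by (intro mellin_transform_pair_le) auto
next
  case False
  have flip: "(x powr d / t powr d - x powr c / t powr c) / (t - x) =
      - ((x powr c / t powr c - x powr d / t powr d) / (t - x))" for t
    by (simp add: minus_divide_left)
  from False have "has_bochner_integral lborel
    (\<lambda>t. - (indicator {x<..} t *\<^sub>R
       (of_real ((x powr d / t powr d - x powr c / t powr c) / (t - x)) * of_real t powr (- s))))
    (- (of_real x powr (- s) * (Digamma (of_real c + s) - Digamma (of_real d + s))))"
    using assms by (intro has_bochner_integral_minus mellin_transform_pair_le) auto
  then have "has_bochner_integral lborel
    (\<lambda>t. indicator {x<..} t *\<^sub>R
       (of_real ((x powr c / t powr c - x powr d / t powr d) / (t - x)) * of_real t powr (- s)))
    (- (of_real x powr (- s) * (Digamma (of_real c + s) - Digamma (of_real d + s))))"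
    unfolding flip of_real_minus mult_minus_left scaleR_minus_right minus_minus .
  also have "- (of_real x powr (- s) * (Digamma (of_real c + s) - Digamma (of_real d + s))) =
    of_real x powr (- s) * (Digamma (of_real d + s) - Digamma (of_real c + s))"
    by (simp add: algebra_simps)
  finally show ?thesis .
qed

text \<open>By Bernoulli's inequality for a natural number \<open>n\<close> above both exponents: both powers lie in the
  interval from \<open>u\<^sup>n\<close> to \<open>1\<close>, whose length is at most \<open>n (1 - u)\<close>.\<close>

lemma powr_diff_bound:
  fixes c d :: real
  assumes "0 \<le> c" "0 \<le> d"
  shows "\<exists>M\<ge>0. \<forall>u. 0 < u \<longrightarrow> u < 1 \<longrightarrow> \<bar>u powr c - u powr d\<bar> \<le> M * (1 - u)"
proof -
  obtain n :: nat where n: "real n \<ge> max c d" using real_arch_simple by blast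
  have "\<bar>u powr c - u powr d\<bar> \<le> real n * (1 - u)" if u: "0 < u" "u < 1" for u
  proof -
    have "1 + real n * (u - 1) \<le> (1 + (u - 1)) ^ n"
      using u by (intro Bernoulli_inequality) auto
    then have "1 - u powr real n \<le> real n * (1 - u)"
      using u by (simp add: powr_realpow algebra_simps)
    moreover have "u powr e \<in> {u powr real n..1}" if "0 \<le> e" "e \<le> real n" for e
      using u that by (auto intro!: powr_mono' powr_le1)
    from this[of c] this[of d] have "\<bar>u powr c - u powr d\<bar> \<le> 1 - u powr real n"
      using assms n by auto
    ultimately show ?thesis by linarith
  qed
  then show ?thesis by (intro exI[of _ "real n"]) auto
qed

context meijer_parameters
begin

definition volterra_kernel :: "real \<Rightarrow> real \<Rightarrow> real" where
  "volterra_kernel x t = (\<Sum>k=1..p. x powr a k / t powr a k - x powr b k / t powr b k) / (t - x)"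

text \<open>In terms of \<open>G\<close> and its Mellin transform: integration against this kernel corresponds to
  multiplication by \<open>Q\<close>.\<close>

lemma mellin_transform_volterra_kernel:
  assumes "x > 0" "Re s > 0"
  shows "has_bochner_integral lborel
    (\<lambda>t. indicator {x<..} t *\<^sub>R (of_real (volterra_kernel x t) * of_real t powr (- s)))
    (of_real x powr (- s) * digamma_excess s)"
proof -
  have "has_bochner_integral lborel
    (\<lambda>t. \<Sum>k=1..p. indicator {x<..} t *\<^sub>R
       (of_real ((x powr a k / t powr a k - x powr b k / t powr b k) / (t - x)) * of_real t powr (- s)))
    (\<Sum>k=1..p. of_real x powr (- s) * (Digamma (of_real (b k) + s) - Digamma (of_real (a k) + s)))"
    using assms a_nonneg b_nonneg by (intro has_bochner_integral_sum mellin_transform_pair) auto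
  then show ?thesis
    by (simp only: volterra_kernel_def digamma_excess_def sum_divide_distrib of_real_sum
          sum_distrib_left sum_distrib_right scaleR_sum_right)
qed

text \<open>The zero of the numerator cancels the pole at \<open>t = x\<close>.\<close>

lemma volterra_kernel_bound:
  obtains M where "M \<ge> 0" and "\<And>x t. 0 < x \<Longrightarrow> x < t \<Longrightarrow> \<bar>volterra_kernel x t\<bar> \<le> M / t"
proof -
  have "\<forall>k\<in>{1..p}. \<exists>M\<ge>0. \<forall>u. 0 < u \<longrightarrow> u < 1 \<longrightarrow> \<bar>u powr a k - u powr b k\<bar> \<le> M * (1 - u)"
    using powr_diff_bound a_nonneg b_nonneg by blast
  then obtain M where M: "\<And>k. k \<in> {1..p} \<Longrightarrow> M k \<ge> 0"
    "\<And>k u. k \<in> {1..p} \<Longrightarrow> 0 < u \<Longrightarrow> u < 1 \<Longrightarrow> \<bar>u powr a k - u powr b k\<bar> \<le> M k * (1 - u)"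
    by metis
  show ?thesis
  proof (rule that[of "\<Sum>k=1..p. M k"])
    show "(\<Sum>k=1..p. M k) \<ge> 0" using M(1) by (intro sum_nonneg) auto
    fix x t :: real assume xt: "0 < x" "x < t"
    have "\<bar>\<Sum>k=1..p. x powr a k / t powr a k - x powr b k / t powr b k\<bar> \<le> (\<Sum>k=1..p. M k * (1 - x / t))"
    proof (intro order_trans[OF sum_abs] sum_mono)
      fix k assume k: "k \<in> {1..p}"
      show "\<bar>x powr a k / t powr a k - x powr b k / t powr b k\<bar> \<le> M k * (1 - x / t)"
        using M(2)[OF k, of "x / t"] xt by (simp add: powr_divide)
    qed
    also have "\<dots> = (\<Sum>k=1..p. M k) * (t - x) / t"
      using xt by (simp only: sum_distrib_right[symmetric]) (simp add: diff_divide_distrib right_diff_distrib)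
    finally show "\<bar>volterra_kernel x t\<bar> \<le> (\<Sum>k=1..p. M k) / t"
      using xt by (simp add: volterra_kernel_def field_simps)
  qed
qed

end

section \<open>An integrable logarithmic singularity\<close>

lemma set_integrable_ln_powr_left:
  fixes x m :: real
  assumes "0 < x" "x < 1" "0 < m"
  shows "set_integrable lborel {x<..<1} (\<lambda>t. (- ln t) powr (m - 1) / t)"
proof -
  have "set_integrable lborel (einterval (ereal x) (ereal 1)) (\<lambda>t. (- ln t) powr (m - 1) / t)"
  proof (rule interval_integral_FTC_nonneg(1)[where F = "\<lambda>t. - ((- ln t) powr m) / m"
        and A = "- ((- ln x) powr m) / m" and B = "- ((- ln 1) powr m) / m"])
    fix t assume "ereal x < ereal t" "ereal t < ereal 1"
    then have t: "0 < t" "t < 1" using assms by auto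
    then show "((\<lambda>t. - ((- ln t) powr m) / m) has_real_derivative (- ln t) powr (m - 1) / t) (at t)"
      using assms by (auto intro!: derivative_eq_intros)
    show "isCont (\<lambda>t. (- ln t) powr (m - 1) / t) t" using t by (intro continuous_intros) auto
  next
    have "((\<lambda>t. - ((- ln t) powr m) / m) \<longlongrightarrow> - ((- ln x) powr m) / m) (at_right x)"
      using assms by (intro tendsto_intros) auto
    then show "(((\<lambda>t. - ((- ln t) powr m) / m) \<circ> real_of_ereal) \<longlongrightarrow> - ((- ln x) powr m) / m) (at_right (ereal x))"
      by (simp add: ereal_tendsto_simps)
    have ev: "\<forall>\<^sub>F t in at_left (1::real). 0 \<le> - ln t"
      using eventually_at_left_real[OF zero_less_one] by (rule eventually_mono) (auto intro: ln_le_zero_iff[THEN iffD2])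
    have "((\<lambda>t. - ((- ln t) powr m) / m) \<longlongrightarrow> - ((- ln 1) powr m) / m) (at_left 1)"
      using assms by (intro tendsto_divide tendsto_minus tendsto_powr' tendsto_ln tendsto_ident_at tendsto_const)
        (use ev in auto)
    then show "(((\<lambda>t. - ((- ln t) powr m) / m) \<circ> real_of_ereal) \<longlongrightarrow> - ((- ln 1) powr m) / m) (at_left (ereal 1))"
      by (simp add: ereal_tendsto_simps)
  qed (use assms in auto)
  then show ?thesis by simp
qed

lemma set_integrable_ln_powr_right:
  fixes m :: real
  assumes "0 < m"
  shows "set_integrable lborel {1<..<exp 1} (\<lambda>t. (ln t) powr (m - 1) / t)"
proof -
  have "set_integrable lborel (einterval (ereal 1) (ereal (exp 1))) (\<lambda>t. (ln t) powr (m - 1) / t)"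
  proof (rule interval_integral_FTC_nonneg(1)[where F = "\<lambda>t. (ln t) powr m / m"
        and A = "(ln 1) powr m / m" and B = "(ln (exp 1)) powr m / m"])
    fix t :: real assume "ereal 1 < ereal t"
    then have t: "1 < t" by simp
    then show "((\<lambda>t. (ln t) powr m / m) has_real_derivative (ln t) powr (m - 1) / t) (at t)"
      using assms by (auto intro!: derivative_eq_intros)
    show "isCont (\<lambda>t. (ln t) powr (m - 1) / t) t" using t by (intro continuous_intros) auto
  next
    have ev: "\<forall>\<^sub>F t in at_right (1::real). 0 \<le> ln t"
      using eventually_at_right[of 1 "2::real"] by (auto intro!: exI[of _ 2])
    have "((\<lambda>t. (ln t) powr m / m) \<longlongrightarrow> (ln 1) powr m / m) (at_right 1)"
      using assms by (intro tendsto_divide tendsto_powr' tendsto_ln tendsto_ident_at tendsto_const)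
        (use ev in auto)
    then show "(((\<lambda>t. (ln t) powr m / m) \<circ> real_of_ereal) \<longlongrightarrow> (ln 1) powr m / m) (at_right (ereal 1))"
      by (simp add: ereal_tendsto_simps)
    have "((\<lambda>t. (ln t) powr m / m) \<longlongrightarrow> (ln (exp 1)) powr m / m) (at_left (exp 1))"
      using assms by (intro tendsto_intros) auto
    then show "(((\<lambda>t. (ln t) powr m / m) \<circ> real_of_ereal) \<longlongrightarrow> (ln (exp 1)) powr m / m) (at_left (ereal (exp 1)))"
      by (simp add: ereal_tendsto_simps)
  qed auto
  then show ?thesis by simp
qed

text \<open>Near \<open>t = 1\<close> the weight \<open>1 / t\<close> provides the antiderivative \<open>\<bar>ln t\<bar> powr m / m\<close> on either side
  of the singularity; from \<open>exp 1\<close> onwards the logarithmic factor is at most \<open>1\<close> and \<open>1 / t\<^sup>2\<close> takes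
  over.\<close>

lemma set_integrable_ln_powr_tail:
  fixes x m :: real
  assumes x: "0 < x" "x < 1" and m: "0 < m" "m < 1"
  shows "set_integrable lborel {x<..} (\<lambda>t. \<bar>ln t\<bar> powr (m - 1) / t\<^sup>2)"
  unfolding set_integrable_def
proof (rule Bochner_Integration.integrable_bound)
  let ?A = "\<lambda>t. indicator {x<..<1} t *\<^sub>R ((- ln t) powr (m - 1) / t)"
  let ?B = "\<lambda>t. indicator {1<..<exp 1} t *\<^sub>R ((ln t) powr (m - 1) / t)"
  let ?E = "\<lambda>t. indicator {x<..} t *\<^sub>R (t powr (- 1 - 1))"
  show "integrable lborel (\<lambda>t. 1 / x * ?A t + ?B t + ?E t)"
    using set_integrable_ln_powr_left[OF x m(1)] set_integrable_ln_powr_right[OF m(1)]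
      set_integrable_powr_tail[OF x(1) zero_less_one]
    unfolding set_integrable_def by (intro Bochner_Integration.integrable_add integrable_mult_right)
  have le: "\<bar>ln t\<bar> powr (m - 1) / t\<^sup>2 \<le> 1 / x * ?A t + ?B t + ?E t" if t: "t > x" for t
  proof -
    have tp: "t > 0" using t x by simp
    have E: "?E t = 1 / t\<^sup>2" using t tp by (simp add: powr_minus powr_numeral divide_inverse)
    consider "t < 1" | "t = 1" | "1 < t" "t < exp 1" | "exp 1 \<le> t" by linarith
    then show ?thesis
    proof cases
      case 1
      have "\<bar>ln t\<bar> powr (m - 1) / t\<^sup>2 = 1 / t * ((- ln t) powr (m - 1) / t)"
        using 1 tp by (simp add: power2_eq_square)
      also have "\<dots> \<le> 1 / x * ((- ln t) powr (m - 1) / t)"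
        using t x tp by (intro mult_right_mono divide_left_mono) auto
      finally have "\<bar>ln t\<bar> powr (m - 1) / t\<^sup>2 \<le> 1 / x * ((- ln t) powr (m - 1) / t)" .
      also have "\<dots> \<le> 1 / x * ?A t + ?B t + ?E t" using 1 t E by simp
      finally show ?thesis .
    next
      case 2
      then show ?thesis using E by simp
    next
      case 3
      have "\<bar>ln t\<bar> powr (m - 1) / t\<^sup>2 = 1 / t * ((ln t) powr (m - 1) / t)"
        using 3 by (simp add: power2_eq_square)
      also have "\<dots> \<le> 1 * ((ln t) powr (m - 1) / t)"
        using 3 tp by (intro mult_right_mono) auto
      finally have "\<bar>ln t\<bar> powr (m - 1) / t\<^sup>2 \<le> 1 * ((ln t) powr (m - 1) / t)" .
      also have "\<dots> \<le> 1 / x * ?A t + ?B t + ?E t" using 3 t E by simp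
      finally show ?thesis .
    next
      case 4
      \<comment> \<open>The exponent \<open>m - 1\<close> is negative.\<close>
      have "ln t \<ge> 1" using 4 tp by (simp add: ln_ge_iff)
      then have "\<bar>ln t\<bar> powr (m - 1) \<le> 1 powr (m - 1)" using m by (intro powr_mono2') auto
      then have "\<bar>ln t\<bar> powr (m - 1) / t\<^sup>2 \<le> 1 / t\<^sup>2" by (intro divide_right_mono) auto
      moreover have "\<not> t < 1" using 4 exp_ge_add_one_self[of 1] by simp
      ultimately show ?thesis using 4 E by simp
    qed
  qed
  show "AE t in lborel. norm (indicator {x<..} t *\<^sub>R (\<bar>ln t\<bar> powr (m - 1) / t\<^sup>2)) \<le>
      norm (1 / x * ?A t + ?B t + ?E t)"
  proof (rule AE_I2)
    fix t :: real
    show "norm (indicator {x<..} t *\<^sub>R (\<bar>ln t\<bar> powr (m - 1) / t\<^sup>2)) \<le> norm (1 / x * ?A t + ?B t + ?E t)"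
    proof (cases "x < t")
      case True
      from le[OF this] True show ?thesis by simp
    qed simp
  qed
qed measurable

section \<open>The integral equation\<close>

context meijer_parameters
begin

lemma line_symbol_bounded:
  obtains B where "B \<ge> 0" "\<And>\<tau>. norm (line_symbol \<tau>) \<le> B"
proof -
  obtain C where C: "C \<ge> 0" "\<And>s. Re s \<ge> 1 \<Longrightarrow> norm (gamma_quotient s) \<le> C * norm s powr (- decay)"
    using gamma_quotient_bound by blast
  have "norm (line_symbol \<tau>) \<le> C" for \<tau>
  proof -
    have "norm (Complex 1 \<tau>) \<ge> 1" using complex_Re_le_cmod[of "Complex 1 \<tau>"] by simp
    then have "norm (Complex 1 \<tau>) powr (- decay) \<le> 1 powr (- decay)"
      using decay by (intro powr_mono2') auto
    then have "C * norm (Complex 1 \<tau>) powr (- decay) \<le> C * 1" using C(1) by (intro mult_left_mono) auto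
    then show ?thesis using C(2)[of "Complex 1 \<tau>"] by (simp add: line_symbol_def)
  qed
  then show ?thesis using that C(1) by blast
qed

lemma continuous_on_line_symbol: "continuous_on S line_symbol"
proof -
  obtain C where "symbol_with_decay line_symbol line_symbol_deriv C decay"
    using symbol_with_decay_line_symbol by blast
  then show ?thesis by (rule symbol_with_decay.cont)
qed

lemma measurable_volterra_kernel [measurable]: "volterra_kernel x \<in> borel_measurable borel"
  unfolding volterra_kernel_def[abs_def] by measurable

text \<open>On a bounded segment the symbol is bounded, and \<open>K(x,t) / t\<close> is of order \<open>1 / t\<^sup>2\<close>, so the double
  integral converges absolutely.\<close>

lemma fubini_volterra_bromwich:
  assumes x: "x > 0"
  shows "has_bochner_integral lborel
    (\<lambda>t. indicator {x<..} t *\<^sub>R (of_real (volterra_kernel x t) * bromwich R t))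
    (1 / (2 * of_real pi) * integral {-R..R} (\<lambda>\<tau>. line_symbol \<tau> * digamma_excess (Complex 1 \<tau>) *
      of_real x powr (- Complex 1 \<tau>)))"
proof -
  define g where "g t \<tau> = indicator {x<..} t *\<^sub>R indicator {-R..R} \<tau> *\<^sub>R
    (of_real (volterra_kernel x t / t) * (line_symbol \<tau> * cis (- ln t * \<tau>)))" for t \<tau>
  obtain M where M: "M \<ge> 0" "\<And>x t. 0 < x \<Longrightarrow> x < t \<Longrightarrow> \<bar>volterra_kernel x t\<bar> \<le> M / t"
    using volterra_kernel_bound by blast
  obtain B where B: "B \<ge> 0" "\<And>\<tau>. norm (line_symbol \<tau>) \<le> B" using line_symbol_bounded by blast
  have [measurable]: "line_symbol \<in> borel_measurable borel"
    using continuous_on_line_symbol by (rule borel_measurable_continuous_onI)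
  have [measurable]: "cis \<in> borel_measurable borel"
    by (rule borel_measurable_continuous_onI) (intro continuous_intros)
  have meas: "case_prod g \<in> borel_measurable (lborel \<Otimes>\<^sub>M lborel)"
    unfolding g_def[abs_def] by measurable
  define u where "u t = indicator {x<..} t *\<^sub>R t powr (- 1 - 1)" for t
  define v where "v \<tau> = M * B * indicator {-R..R} \<tau>" for \<tau> :: real
  have u_int: "integrable lborel u"
    using set_integrable_powr_tail[OF x zero_less_one] by (simp add: u_def[abs_def] set_integrable_def)
  have v_int: "integrable lborel v"
    unfolding v_def[abs_def] by (intro integrable_mult_right) (simp add: integrable_indicator_iff emeasure_lborel_Icc_eq)
  have g_le: "norm (g t \<tau>) \<le> norm (u t * v \<tau>)" for t \<tau>
  proof (cases "x < t \<and> \<tau> \<in> {-R..R}")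
    case True
    then have t: "t > 0" using x by simp
    have "norm (g t \<tau>) = \<bar>volterra_kernel x t\<bar> / t * norm (line_symbol \<tau>)"
      using True t by (simp add: g_def norm_mult norm_divide)
    also have "\<dots> \<le> M / t / t * B"
      using M B t True x by (intro mult_mono divide_right_mono) auto
    also have "\<dots> = u t * v \<tau>"
      using True t by (simp add: u_def v_def powr_minus powr_numeral divide_inverse power2_eq_square)
    finally show ?thesis by (simp add: order_trans[OF _ abs_ge_self])
  qed (auto simp: g_def)
  have uv: "integrable (lborel \<Otimes>\<^sub>M lborel) (\<lambda>(t, \<tau>). u t * v \<tau>)"
  proof (rule lborel_pair.Fubini_integrable)
    have [measurable]: "u \<in> borel_measurable borel" "v \<in> borel_measurable borel"
      using u_int v_int by (auto dest: borel_measurable_integrable)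
    show "(\<lambda>(t, \<tau>). u t * v \<tau>) \<in> borel_measurable (lborel \<Otimes>\<^sub>M lborel)" by measurable
    have "integrable lborel (\<lambda>t. norm (u t) * (\<integral>\<tau>. norm (v \<tau>) \<partial>lborel))"
      using u_int by (intro integrable_mult_left integrable_norm)
    then show "integrable lborel (\<lambda>t. \<integral>\<tau>. norm (case (t, \<tau>) of (t, \<tau>) \<Rightarrow> u t * v \<tau>) \<partial>lborel)"
      by (simp add: abs_mult)
    show "AE t in lborel. integrable lborel (\<lambda>\<tau>. case (t, \<tau>) of (t, \<tau>) \<Rightarrow> u t * v \<tau>)"
      using v_int by simp
  qed
  have g_int: "integrable (lborel \<Otimes>\<^sub>M lborel) (case_prod g)"
    by (rule Bochner_Integration.integrable_bound[OF uv meas]) (use g_le[unfolded real_norm_def] in auto)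
  have inner1: "(\<integral>\<tau>. g t \<tau> \<partial>lborel) =
      2 * of_real pi * (indicator {x<..} t *\<^sub>R (of_real (volterra_kernel x t) * bromwich R t))" for t
  proof (cases "x < t")
    case True
    then have t: "t > 0" using x by simp
    have si: "set_integrable lborel {-R..R} (\<lambda>\<tau>. line_symbol \<tau> * cis (- ln t * \<tau>))"
      by (intro borel_integrable_compact[unfolded set_integrable_def[symmetric]] compact_Icc continuous_intros
            continuous_on_line_symbol)
    have ind: "indicator {x<..} t = (1 :: real)" using True by simp
    have "(\<integral>\<tau>. g t \<tau> \<partial>lborel) = (LBINT \<tau>:{-R..R}. of_real (volterra_kernel x t / t) * (line_symbol \<tau> * cis (- ln t * \<tau>)))"
      by (simp only: g_def set_lebesgue_integral_def ind scaleR_one)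
    also have "\<dots> = of_real (volterra_kernel x t / t) * (LBINT \<tau>:{-R..R}. line_symbol \<tau> * cis (- ln t * \<tau>))"
      by (rule set_integral_mult_right)
    also have "(LBINT \<tau>:{-R..R}. line_symbol \<tau> * cis (- ln t * \<tau>)) = integral {-R..R} (\<lambda>\<tau>. line_symbol \<tau> * cis (- ln t * \<tau>))"
      by (rule set_borel_integral_eq_integral(2)[OF si])
    finally show ?thesis using True t by (simp add: bromwich_eq_fourier[OF t])
  qed (simp add: g_def)
  have inner2: "(\<integral>t. g t \<tau> \<partial>lborel) =
      indicator {-R..R} \<tau> *\<^sub>R (line_symbol \<tau> * digamma_excess (Complex 1 \<tau>) * of_real x powr (- Complex 1 \<tau>))" for \<tau>
  proof -
    have "(\<integral>t. g t \<tau> \<partial>lborel) = (\<integral>t. (indicator {-R..R} \<tau> *\<^sub>R line_symbol \<tau>) *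
        (indicator {x<..} t *\<^sub>R (of_real (volterra_kernel x t) * of_real t powr (- Complex 1 \<tau>))) \<partial>lborel)"
    proof (intro Bochner_Integration.integral_cong refl)
      fix t
      show "g t \<tau> = (indicator {-R..R} \<tau> *\<^sub>R line_symbol \<tau>) *
        (indicator {x<..} t *\<^sub>R (of_real (volterra_kernel x t) * of_real t powr (- Complex 1 \<tau>)))"
      proof (cases "x < t")
        case True
        then have "t > 0" using x by simp
        from powr_line[OF this] show ?thesis by (simp add: g_def scaleR_conv_of_real mult_ac)
      qed (simp add: g_def)
    qed
    also have "\<dots> = (indicator {-R..R} \<tau> *\<^sub>R line_symbol \<tau>) * (of_real x powr (- Complex 1 \<tau>) * digamma_excess (Complex 1 \<tau>))"
      using x by (intro has_bochner_integral_integral_eq has_bochner_integral_mult_right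
        mellin_transform_volterra_kernel) simp_all
    finally show ?thesis by (simp add: mult_ac)
  qed
  have cC: "continuous_on {-R..R} (\<lambda>\<tau>. Complex 1 \<tau>)"
    unfolding Complex_eq by (intro continuous_intros)
  have si: "set_integrable lborel {-R..R} (\<lambda>\<tau>. line_symbol \<tau> * digamma_excess (Complex 1 \<tau>) * of_real x powr (- Complex 1 \<tau>))"
    unfolding powr_line[OF x]
    by (intro borel_integrable_compact[unfolded set_integrable_def[symmetric]] compact_Icc continuous_intros
          continuous_on_line_symbol continuous_on_compose2[OF continuous_on_digamma_excess cC]) auto
  have "(\<integral>t. (\<integral>\<tau>. g t \<tau> \<partial>lborel) \<partial>lborel) = (\<integral>\<tau>. (\<integral>t. g t \<tau> \<partial>lborel) \<partial>lborel)"
    using lborel_pair.Fubini_integral[OF g_int] by simp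
  also have "\<dots> = (LBINT \<tau>:{-R..R}. line_symbol \<tau> * digamma_excess (Complex 1 \<tau>) * of_real x powr (- Complex 1 \<tau>))"
    by (simp only: inner2 set_lebesgue_integral_def)
  also have "\<dots> = integral {-R..R} (\<lambda>\<tau>. line_symbol \<tau> * digamma_excess (Complex 1 \<tau>) * of_real x powr (- Complex 1 \<tau>))"
    by (rule set_borel_integral_eq_integral(2)[OF si])
  finally have eq: "(\<integral>t. (\<integral>\<tau>. g t \<tau> \<partial>lborel) \<partial>lborel) = \<dots>" .
  have "integrable lborel (\<lambda>t. \<integral>\<tau>. g t \<tau> \<partial>lborel)"
    using lborel_pair.integrable_fst[OF g_int] by simp
  with eq have "has_bochner_integral lborel (\<lambda>t. \<integral>\<tau>. g t \<tau> \<partial>lborel)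
    (integral {-R..R} (\<lambda>\<tau>. line_symbol \<tau> * digamma_excess (Complex 1 \<tau>) * of_real x powr (- Complex 1 \<tau>)))"
    by (simp add: has_bochner_integral_iff)
  from has_bochner_integral_mult_right[OF this, of "1 / (2 * of_real pi)"] show ?thesis
    unfolding inner1 by (simp add: mult.assoc[symmetric])
qed

text \<open>The right-hand side of the Fubini identity, evaluated by parts.\<close>

lemma bromwich_volterra_limit:
  assumes x: "0 < x" "x < 1"
  shows "((\<lambda>R. 1 / (2 * of_real pi) * integral {-R..R} (\<lambda>\<tau>. line_symbol \<tau> * digamma_excess (Complex 1 \<tau>) *
      of_real x powr (- Complex 1 \<tau>))) \<longlongrightarrow> of_real (ln (1 / x)) * meijer_G p b a x) at_top"
proof -
  have z: "((\<lambda>R. of_real (1 / (2 * pi * x)) * (line_symbol R * cis (- ln x * R) - line_symbol (- R) * cis (ln x * R)) / \<i>)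
      \<longlongrightarrow> of_real (1 / (2 * pi * x)) * (0 - 0) / \<i>) at_top"
  proof (intro tendsto_intros)
    show "((\<lambda>R. line_symbol R * cis (- ln x * R)) \<longlongrightarrow> 0) at_top"
      by (rule Lim_null_comparison[OF _ tendsto_norm_zero[OF line_symbol_tendsto_0(1)]]) (simp add: norm_mult)
    show "((\<lambda>R. line_symbol (- R) * cis (ln x * R)) \<longlongrightarrow> 0) at_top"
      by (rule Lim_null_comparison[OF _ tendsto_norm_zero[OF line_symbol_tendsto_0(2)]]) (simp add: norm_mult)
  qed auto
  have "((\<lambda>R. of_real (ln (1 / x)) * bromwich R x -
      of_real (1 / (2 * pi * x)) * (line_symbol R * cis (- ln x * R) - line_symbol (- R) * cis (ln x * R)) / \<i>)
      \<longlongrightarrow> of_real (ln (1 / x)) * meijer_G p b a x - of_real (1 / (2 * pi * x)) * (0 - 0) / \<i>) at_top"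
    by (rule tendsto_diff[OF tendsto_mult_left[OF bromwich_tendsto_meijer_G[OF x]] z])
  moreover have "\<forall>\<^sub>F R in at_top. of_real (ln (1 / x)) * bromwich R x -
      of_real (1 / (2 * pi * x)) * (line_symbol R * cis (- ln x * R) - line_symbol (- R) * cis (ln x * R)) / \<i> =
      1 / (2 * of_real pi) * integral {-R..R} (\<lambda>\<tau>. line_symbol \<tau> * digamma_excess (Complex 1 \<tau>) *
      of_real x powr (- Complex 1 \<tau>))"
    using eventually_ge_at_top[of 0]
    by eventually_elim (subst bromwich_by_parts[OF x(1)], auto)
  ultimately show ?thesis using Lim_transform_eventually by fastforce
qed

text \<open>Dominated convergence in the Fubini identity along \<open>R = 0, 1, 2, \<dots>\<close>. The integrals run over all
  \<open>t > x\<close>, but beyond \<open>1\<close> the integrand tends to \<open>0\<close>; the single point \<open>t = 1\<close>, where the truncated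
  integrals need not converge, is a null set.\<close>

lemma meijer_G_volterra_equation:
  assumes x: "0 < x" "x < 1"
  shows "has_bochner_integral lborel
    (\<lambda>t. indicator {x<..<1} t *\<^sub>R (meijer_G p b a t * of_real (volterra_kernel x t)))
    (of_real (ln (1 / x)) * meijer_G p b a x)"
proof -
  define h where "h n t = indicator {x<..} t *\<^sub>R (of_real (volterra_kernel x t) * bromwich (real n) t)" for n t
  define H where "H t = indicator {x<..<1} t *\<^sub>R (meijer_G p b a t * of_real (volterra_kernel x t))" for t
  obtain M where M: "M \<ge> 0" "\<And>x t. 0 < x \<Longrightarrow> x < t \<Longrightarrow> \<bar>volterra_kernel x t\<bar> \<le> M / t"
    using volterra_kernel_bound by blast
  obtain D where D: "D \<ge> 0"
    "\<And>R t. R \<ge> 0 \<Longrightarrow> t > 0 \<Longrightarrow> t \<noteq> 1 \<Longrightarrow> norm (bromwich R t) \<le> D / t * \<bar>ln t\<bar> powr (decay - 1)"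
    using bromwich_bound by blast
  \<comment> \<open>The product of the bounds for the kernel and for the truncated integrals.\<close>
  define w where "w t = M * D * (indicator {x<..} t *\<^sub>R (\<bar>ln t\<bar> powr (decay - 1) / t\<^sup>2))" for t
  have w_int: "integrable lborel w"
    using set_integrable_ln_powr_tail[OF x decay(1,2)] unfolding w_def[abs_def] set_integrable_def
    by (intro integrable_mult_right)
  have h_int: "has_bochner_integral lborel (h n) (1 / (2 * of_real pi) * integral {-real n..real n}
      (\<lambda>\<tau>. line_symbol \<tau> * digamma_excess (Complex 1 \<tau>) * of_real x powr (- Complex 1 \<tau>)))" for n
    unfolding h_def[abs_def] by (rule fubini_volterra_bromwich[OF x(1)])
  have h_meas [measurable]: "h n \<in> borel_measurable lborel" for n
    using h_int[of n] by (auto simp: has_bochner_integral_iff)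
  have h_le: "norm (h n t) \<le> w t" if "t \<noteq> 1" for n t
  proof (cases "x < t")
    case True
    then have t: "t > 0" using x by simp
    have "norm (h n t) = \<bar>volterra_kernel x t\<bar> * norm (bromwich (real n) t)"
      using True by (simp add: h_def norm_mult)
    also have "\<dots> \<le> M / t * (D / t * \<bar>ln t\<bar> powr (decay - 1))"
      using M D t True x that by (intro mult_mono) auto
    also have "\<dots> = w t" using True by (simp add: w_def power2_eq_square)
    finally show ?thesis .
  qed (simp add: h_def w_def)
  have brom: "(\<lambda>n. bromwich (real n) t) \<longlonglongrightarrow> (if t < 1 then meijer_G p b a t else 0)" if "t > 0" "t \<noteq> 1" for t
    using that bromwich_tendsto_meijer_G[of t] bromwich_tendsto_0[of t]
    by (auto intro: filterlim_compose[OF _ filterlim_real_sequentially])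
  have h_lim: "(\<lambda>n. h n t) \<longlonglongrightarrow> H t" if "t \<noteq> 1" for t
  proof (cases "x < t")
    case True
    have "(\<lambda>n. of_real (volterra_kernel x t) * bromwich (real n) t) \<longlonglongrightarrow>
        of_real (volterra_kernel x t) * (if t < 1 then meijer_G p b a t else 0)"
      using True x that by (intro tendsto_mult_left brom) auto
    moreover have "H t = of_real (volterra_kernel x t) * (if t < 1 then meijer_G p b a t else 0)"
      using True that by (simp add: H_def mult.commute)
    ultimately show ?thesis using True by (simp add: h_def)
  qed (simp add: h_def H_def)
  have H_meas: "H \<in> borel_measurable lborel"
  proof (rule borel_measurable_LIMSEQ_metric)
    show "(\<lambda>t. indicator (- {1}) t *\<^sub>R h n t) \<in> borel_measurable lborel" for n by measurable
    show "(\<lambda>n. indicator (- {1}) t *\<^sub>R h n t) \<longlonglongrightarrow> H t" for t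
      using h_lim[of t] by (cases "t = 1") (auto simp: H_def)
  qed
  have lim: "AE t in lborel. (\<lambda>n. h n t) \<longlonglongrightarrow> H t"
    using AE_lborel_singleton[of "1::real"] by eventually_elim (rule h_lim)
  have bound: "AE t in lborel. norm (h n t) \<le> w t" for n
    using AE_lborel_singleton[of "1::real"] by eventually_elim (rule h_le)
  have "integrable lborel H"
    by (rule integrable_dominated_convergence[OF H_meas h_meas w_int lim bound])
  moreover have "(\<lambda>n. integral\<^sup>L lborel (h n)) \<longlonglongrightarrow> integral\<^sup>L lborel H"
    by (rule integral_dominated_convergence[OF H_meas h_meas w_int lim bound])
  moreover have "(\<lambda>n. integral\<^sup>L lborel (h n)) \<longlonglongrightarrow> of_real (ln (1 / x)) * meijer_G p b a x"
    using filterlim_compose[OF bromwich_volterra_limit[OF x] filterlim_real_sequentially] h_int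
    by (simp add: has_bochner_integral_iff)
  ultimately show ?thesis
    using LIMSEQ_unique by (auto simp: has_bochner_integral_iff H_def[abs_def])
qed

end

theorem theorem2:
  fixes p :: nat and a b :: "nat \<Rightarrow> real" and x :: real
  assumes "p \<ge> 1"
    and "\<And>k. k \<in> {1..p} \<Longrightarrow> a k \<ge> 0"
    and "\<And>k. k \<in> {1..p} \<Longrightarrow> b k \<ge> 0"
    and "(\<Sum>k=1..p. b k - a k) > 0"
    and "0 < x" and "x < 1"
  shows "set_integrable lborel {x<..<1}
           (\<lambda>t. meijer_G p b a t *
              of_real ((\<Sum>k=1..p. x powr a k / t powr a k - x powr b k / t powr b k) / (t - x)))
       \<and> of_real (ln (1 / x)) * meijer_G p b a x =
         (LBINT t:{x<..<1}. meijer_G p b a t *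
              of_real ((\<Sum>k=1..p. x powr a k / t powr a k - x powr b k / t powr b k) / (t - x)))"
proof -
  interpret meijer_parameters p a b
    using assms by unfold_locales auto
  show ?thesis
    using meijer_G_volterra_equation[OF assms(5,6)]
    unfolding volterra_kernel_def has_bochner_integral_iff set_integrable_def set_lebesgue_integral_def
    by simp
qed

end
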